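(* Let $(M,g)=(B\times_f F,\ g_B+f^2g_F)$ be a warped product manifold with $m_1=\dim B$, let $(\overline{M},\overline{g})=(\overline{M}(c),\overline{g},J)$ be a complex space form of constant holomorphic sectional curvature $c$, and let $\psi:(M,g)\to(\overline{M},\overline{g})$ be an isometric immersion. Assume that $(M,g)$ is a 2-dimensional totally geodesic complex submanifold of $(\overline{M},\overline{g})$ (i.e., $J(TM)=TM$). Then $$m_1c\ \le\ \frac{\triangle f}{f}\ \le\ m_1c.$$
   Context: $(B,g_B)$ and $(F,g_F)$ are Riemannian manifolds (of positive dimension), $f:B\to\mathbb{R}^+$ is a smooth positive function (the warping function), and $B\times_f F$ is the product $B\times F$ with the metric $g=g_B+f^2g_F$; $f$ is also regarded as a function on $M$ via the projection to $B$. All dimensions are real. The Laplacian is $\triangle f=\sum_i\big((\nabla_{v_i}v_i)f-v_i^2f\big)$ for a local orthonormal frame $\{v_i\}$ of $TM$, where $\nabla$ is the Levi-Civita connection of $M$ (note the sign). Totally geodesic means that the second fundamental form of the immersion vanishes identically. A complex space form $(\overline{M}(c),\overline{g},J)$ is a Kähler manifold of constant holomorphic sectional curvature $c$; its curvature tensor is $$\overline{R}(X,Y)Z=\tfrac{c}{4}\big(\overline{g}(Y,Z)X-\overline{g}(X,Z)Y+\overline{g}(JY,Z)JX-\overline{g}(JX,Z)JY-2\overline{g}(JX,Y)JZ\big).$$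
   Formalization: The Laplacian of f is taken on the base (B, g_B) and pulled back to M, not on M with a frame of TM: the latter fails for C minus a ray as (0,∞)×_r(−π,π), f=r, c=0, where it gives −1/r² instead of 0. *)

theory Defs
  imports "HOL-Analysis.Analysis"
begin

section \<open>Smooth manifolds\<close>

text \<open>
  \<open>Ck_on k f S\<close> and \<open>smooth_on f S\<close> are meant for open \<open>S\<close>.  The domain is finite-dimensional, so
  it is enough to differentiate the directional derivatives for each fixed direction \<open>v\<close>.
\<close>

primrec Ck_on :: "nat \<Rightarrow> ('e::euclidean_space \<Rightarrow> 'v::real_normed_vector) \<Rightarrow> 'e set \<Rightarrow> bool" where
  "Ck_on 0 f S \<longleftrightarrow> continuous_on S f"
| "Ck_on (Suc k) f S \<longleftrightarrow>
     (\<forall>x\<in>S. f differentiable (at x)) \<and> (\<forall>v. Ck_on k (\<lambda>x. frechet_derivative f (at x) v) S)"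

definition smooth_on :: "('e::euclidean_space \<Rightarrow> 'v::real_normed_vector) \<Rightarrow> 'e set \<Rightarrow> bool" where
  "smooth_on f S \<longleftrightarrow> (\<forall>k. Ck_on k f S)"

text \<open>
  The points of a manifold are all elements of a Hausdorff, second countable type \<open>'m\<close>; its smooth
  structure is an atlas with values in the model space \<open>'e\<close>, so its dimension is \<open>DIM('e)\<close>
  (which is positive).
\<close>

type_synonym ('m, 'e) chart = "'m set \<times> ('m \<Rightarrow> 'e)"
type_synonym ('m, 'e) atlas = "('m, 'e) chart set"

definition chart_inv :: "('m, 'e) chart \<Rightarrow> 'e \<Rightarrow> 'm" where
  "chart_inv c = inv_into (fst c) (snd c)"

definition smooth_atlas ::
    "('m::{t2_space,second_countable_topology}, 'e::euclidean_space) atlas \<Rightarrow> bool" where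
  "smooth_atlas A \<longleftrightarrow>
     (\<Union>c\<in>A. fst c) = UNIV \<and>
     (\<forall>c\<in>A. open (fst c) \<and> open (snd c ` fst c) \<and>
        homeomorphism (fst c) (snd c ` fst c) (snd c) (chart_inv c)) \<and>
     (\<forall>c\<in>A. \<forall>c'\<in>A. smooth_on (snd c' \<circ> chart_inv c) (snd c ` (fst c \<inter> fst c')))"

definition smooth_fun ::
    "('m::{t2_space,second_countable_topology}, 'e::euclidean_space) atlas \<Rightarrow> 'm set
      \<Rightarrow> ('m \<Rightarrow> 'v::real_normed_vector) \<Rightarrow> bool" where
  "smooth_fun A U f \<longleftrightarrow> (\<forall>c\<in>A. smooth_on (f \<circ> chart_inv c) (snd c ` (fst c \<inter> U)))"

definition smooth_map ::
    "('m::{t2_space,second_countable_topology}, 'e::euclidean_space) atlas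
      \<Rightarrow> ('n::{t2_space,second_countable_topology}, 'k::euclidean_space) atlas
      \<Rightarrow> ('m \<Rightarrow> 'n) \<Rightarrow> bool" where
  "smooth_map A A' h \<longleftrightarrow>
     continuous_on UNIV h \<and> (\<forall>c'\<in>A'. smooth_fun A (h -` fst c') (snd c' \<circ> h))"

definition product_atlas :: "('m, 'e) atlas \<Rightarrow> ('n, 'k) atlas \<Rightarrow> ('m \<times> 'n, 'e \<times> 'k) atlas" where
  "product_atlas A A' = {(fst c \<times> fst c', map_prod (snd c) (snd c')) | c c'. c \<in> A \<and> c' \<in> A'}"


section \<open>Tangent vectors and vector fields\<close>

text \<open>
  Every point \<open>p\<close> gets a fixed chart \<open>chart_at A p\<close> around it, and the tangent space at \<open>p\<close> is
  identified with the model space \<open>'e\<close> by the differential of this chart.  Thus a tangent vector at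
  \<open>p\<close> is an element of \<open>'e\<close>, and a vector field is a function \<open>'m \<Rightarrow> 'e\<close>.  As \<open>chart_at A p\<close> need
  not depend continuously on \<open>p\<close>, smoothness of a field is not smoothness of this function; it is
  smoothness of the components of the field in each chart of the atlas.
\<close>

definition chart_at :: "('m, 'e) atlas \<Rightarrow> 'm \<Rightarrow> ('m, 'e) chart" where
  "chart_at A p = (SOME c. c \<in> A \<and> p \<in> fst c)"

text \<open>The derivative at \<open>p\<close>, along the tangent vector \<open>v\<close>, of a function with values in a vector space.\<close>

definition vderiv ::
    "('m, 'e::euclidean_space) atlas \<Rightarrow> ('m \<Rightarrow> 'v::real_normed_vector) \<Rightarrow> 'm \<Rightarrow> 'e \<Rightarrow> 'v" where
  "vderiv A f p v =
     frechet_derivative (f \<circ> chart_inv (chart_at A p)) (at (snd (chart_at A p) p)) v"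

text \<open>The differential at \<open>p\<close> of a map of manifolds.\<close>

definition mdiff ::
    "('m, 'e::euclidean_space) atlas \<Rightarrow> ('n, 'k::euclidean_space) atlas
      \<Rightarrow> ('m \<Rightarrow> 'n) \<Rightarrow> 'm \<Rightarrow> 'e \<Rightarrow> 'k" where
  "mdiff A A' h p v = vderiv A (snd (chart_at A' (h p)) \<circ> h) p v"

text \<open>\<open>vderiv A (snd c) p (X p)\<close> is the vector of components of \<open>X\<close> at \<open>p\<close> in the chart \<open>c\<close>.\<close>

definition smooth_field ::
    "('m::{t2_space,second_countable_topology}, 'e::euclidean_space) atlas \<Rightarrow> 'm set
      \<Rightarrow> ('m \<Rightarrow> 'e) \<Rightarrow> bool" where
  "smooth_field A U X \<longleftrightarrow> (\<forall>c\<in>A. smooth_fun A (U \<inter> fst c) (\<lambda>p. vderiv A (snd c) p (X p)))"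

text \<open>The vector field on the domain of the chart \<open>c\<close> with constant components \<open>w\<close> in that chart.\<close>

definition coord_field ::
    "('m, 'e::euclidean_space) atlas \<Rightarrow> ('m, 'e) chart \<Rightarrow> 'e \<Rightarrow> 'm \<Rightarrow> 'e" where
  "coord_field A c w q = inv (vderiv A (snd c) q) w"

text \<open>
  \<open>[X, Y] x\<^sup>i = X (Y x\<^sup>i) - Y (X x\<^sup>i)\<close> for the coordinates \<open>x\<^sup>i\<close> of the chart that identifies the
  tangent space at \<open>p\<close> with \<open>'e\<close>.
\<close>

definition lie_bracket ::
    "('m, 'e::euclidean_space) atlas \<Rightarrow> ('m \<Rightarrow> 'e) \<Rightarrow> ('m \<Rightarrow> 'e) \<Rightarrow> 'm \<Rightarrow> 'e" where
  "lie_bracket A X Y p =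
     (let x = snd (chart_at A p)
      in vderiv A (\<lambda>q. vderiv A x q (Y q)) p (X p) - vderiv A (\<lambda>q. vderiv A x q (X q)) p (Y p))"


section \<open>Riemannian metrics and the Levi-Civita connection\<close>

definition riemannian_metric ::
    "('m::{t2_space,second_countable_topology}, 'e::euclidean_space) atlas
      \<Rightarrow> ('m \<Rightarrow> 'e \<Rightarrow> 'e \<Rightarrow> real) \<Rightarrow> bool" where
  "riemannian_metric A g \<longleftrightarrow>
     (\<forall>p. bilinear (g p) \<and> (\<forall>u v. g p u v = g p v u) \<and> (\<forall>v. v \<noteq> 0 \<longrightarrow> g p v v > 0)) \<and>
     (\<forall>U X Y. open U \<and> smooth_field A U X \<and> smooth_field A U Y
        \<longrightarrow> smooth_fun A U (\<lambda>p. g p (X p) (Y p)))"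

text \<open>
  A connection \<open>nabla\<close> sends \<open>X\<close>, \<open>Y\<close> to \<open>\<nabla>\<^sub>X Y\<close>.  The axioms are required on every open set, for
  fields that are smooth there; values at points where the arguments are not smooth are irrelevant.
\<close>

definition affine_connection ::
    "('m::{t2_space,second_countable_topology}, 'e::euclidean_space) atlas
      \<Rightarrow> (('m \<Rightarrow> 'e) \<Rightarrow> ('m \<Rightarrow> 'e) \<Rightarrow> 'm \<Rightarrow> 'e) \<Rightarrow> bool" where
  "affine_connection A nabla \<longleftrightarrow>
     (\<forall>U X Y Z h. open U \<and> smooth_field A U X \<and> smooth_field A U Y \<and> smooth_field A U Z
        \<and> smooth_fun A U (h :: 'm \<Rightarrow> real) \<longrightarrow>
        smooth_field A U (nabla X Y) \<and>
        (\<forall>p\<in>U. nabla (\<lambda>q. X q + Y q) Z p = nabla X Z p + nabla Y Z p \<and>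
               nabla (\<lambda>q. h q *\<^sub>R X q) Y p = h p *\<^sub>R nabla X Y p \<and>
               nabla X (\<lambda>q. Y q + Z q) p = nabla X Y p + nabla X Z p \<and>
               nabla X (\<lambda>q. h q *\<^sub>R Y q) p = vderiv A h p (X p) *\<^sub>R Y p + h p *\<^sub>R nabla X Y p))"

definition levi_civita ::
    "('m::{t2_space,second_countable_topology}, 'e::euclidean_space) atlas
      \<Rightarrow> ('m \<Rightarrow> 'e \<Rightarrow> 'e \<Rightarrow> real) \<Rightarrow> (('m \<Rightarrow> 'e) \<Rightarrow> ('m \<Rightarrow> 'e) \<Rightarrow> 'm \<Rightarrow> 'e) \<Rightarrow> bool" where
  "levi_civita A g nabla \<longleftrightarrow>
     affine_connection A nabla \<and>
     (\<forall>U X Y Z. open U \<and> smooth_field A U X \<and> smooth_field A U Y \<and> smooth_field A U Z \<longrightarrow>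
        (\<forall>p\<in>U. nabla X Y p - nabla Y X p = lie_bracket A X Y p \<and>
               vderiv A (\<lambda>q. g q (Y q) (Z q)) p (X p)
                 = g p (nabla X Y p) (Z p) + g p (Y p) (nabla X Z p)))"

definition curvature ::
    "('m, 'e::euclidean_space) atlas \<Rightarrow> (('m \<Rightarrow> 'e) \<Rightarrow> ('m \<Rightarrow> 'e) \<Rightarrow> 'm \<Rightarrow> 'e)
      \<Rightarrow> ('m \<Rightarrow> 'e) \<Rightarrow> ('m \<Rightarrow> 'e) \<Rightarrow> ('m \<Rightarrow> 'e) \<Rightarrow> 'm \<Rightarrow> 'e" where
  "curvature A nabla X Y Z p =
     nabla X (nabla Y Z) p - nabla Y (nabla X Z) p - nabla (lie_bracket A X Y) Z p"

text \<open>The sectional curvature of the plane spanned by \<open>X p\<close> and \<open>Y p\<close>.\<close>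

definition sectional_curvature ::
    "('m, 'e::euclidean_space) atlas \<Rightarrow> ('m \<Rightarrow> 'e \<Rightarrow> 'e \<Rightarrow> real)
      \<Rightarrow> (('m \<Rightarrow> 'e) \<Rightarrow> ('m \<Rightarrow> 'e) \<Rightarrow> 'm \<Rightarrow> 'e) \<Rightarrow> ('m \<Rightarrow> 'e) \<Rightarrow> ('m \<Rightarrow> 'e) \<Rightarrow> 'm \<Rightarrow> real" where
  "sectional_curvature A g nabla X Y p =
     g p (curvature A nabla X Y Y p) (X p)
       / (g p (X p) (X p) * g p (Y p) (Y p) - (g p (X p) (Y p))\<^sup>2)"

definition local_orthonormal_frame ::
    "('m::{t2_space,second_countable_topology}, 'e::euclidean_space) atlas
      \<Rightarrow> ('m \<Rightarrow> 'e \<Rightarrow> 'e \<Rightarrow> real) \<Rightarrow> 'm set \<Rightarrow> (nat \<Rightarrow> 'm \<Rightarrow> 'e) \<Rightarrow> bool" where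
  "local_orthonormal_frame A g U v \<longleftrightarrow>
     open U \<and> (\<forall>i<DIM('e). smooth_field A U (v i)) \<and>
     (\<forall>q\<in>U. \<forall>i<DIM('e). \<forall>j<DIM('e). g q (v i q) (v j q) = (if i = j then 1 else 0))"

text \<open>
  The sign is the one that makes the Laplacian a nonnegative operator.  The sum does not depend on
  the frame.
\<close>

definition laplacian ::
    "('m::{t2_space,second_countable_topology}, 'e::euclidean_space) atlas
      \<Rightarrow> ('m \<Rightarrow> 'e \<Rightarrow> 'e \<Rightarrow> real) \<Rightarrow> (('m \<Rightarrow> 'e) \<Rightarrow> ('m \<Rightarrow> 'e) \<Rightarrow> 'm \<Rightarrow> 'e)
      \<Rightarrow> ('m \<Rightarrow> real) \<Rightarrow> 'm \<Rightarrow> real" where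
  "laplacian A g nabla f p =
     (SOME r. \<exists>U v. local_orthonormal_frame A g U v \<and> p \<in> U \<and>
        r = (\<Sum>i<DIM('e). vderiv A f p (nabla (v i) (v i) p)
                           - vderiv A (\<lambda>q. vderiv A f q (v i q)) p (v i p)))"

definition warped_metric ::
    "('b, 'd::euclidean_space) atlas \<Rightarrow> ('b \<Rightarrow> 'd \<Rightarrow> 'd \<Rightarrow> real)
      \<Rightarrow> ('f, 'e::euclidean_space) atlas \<Rightarrow> ('f \<Rightarrow> 'e \<Rightarrow> 'e \<Rightarrow> real)
      \<Rightarrow> ('b \<Rightarrow> real) \<Rightarrow> 'b \<times> 'f \<Rightarrow> 'd \<times> 'e \<Rightarrow> 'd \<times> 'e \<Rightarrow> real" where
  "warped_metric AB gB AF gF f p u v =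
     gB (fst p) (mdiff (product_atlas AB AF) AB fst p u) (mdiff (product_atlas AB AF) AB fst p v)
     + (f (fst p))\<^sup>2 *
       gF (snd p) (mdiff (product_atlas AB AF) AF snd p u) (mdiff (product_atlas AB AF) AF snd p v)"


section \<open>Complex space forms\<close>

text \<open>
  A Kaehler manifold is given by its metric \<open>g\<close> with Levi-Civita connection \<open>nabla\<close> and a parallel
  orthogonal almost complex structure \<open>J\<close> (parallelism implies that \<open>J\<close> is integrable).
\<close>

definition kaehler ::
    "('m::{t2_space,second_countable_topology}, 'e::euclidean_space) atlas
      \<Rightarrow> ('m \<Rightarrow> 'e \<Rightarrow> 'e \<Rightarrow> real) \<Rightarrow> (('m \<Rightarrow> 'e) \<Rightarrow> ('m \<Rightarrow> 'e) \<Rightarrow> 'm \<Rightarrow> 'e)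
      \<Rightarrow> ('m \<Rightarrow> 'e \<Rightarrow> 'e) \<Rightarrow> bool" where
  "kaehler A g nabla J \<longleftrightarrow>
     smooth_atlas A \<and> riemannian_metric A g \<and> levi_civita A g nabla \<and>
     (\<forall>p. linear (J p) \<and> (\<forall>v. J p (J p v) = - v) \<and> (\<forall>u v. g p (J p u) (J p v) = g p u v)) \<and>
     (\<forall>U X. open U \<and> smooth_field A U X \<longrightarrow> smooth_field A U (\<lambda>q. J q (X q))) \<and>
     (\<forall>U X Y. open U \<and> smooth_field A U X \<and> smooth_field A U Y \<longrightarrow>
        (\<forall>p\<in>U. nabla X (\<lambda>q. J q (Y q)) p = J p (nabla X Y p)))"

definition complex_space_form ::
    "('m::{t2_space,second_countable_topology}, 'e::euclidean_space) atlas
      \<Rightarrow> ('m \<Rightarrow> 'e \<Rightarrow> 'e \<Rightarrow> real) \<Rightarrow> (('m \<Rightarrow> 'e) \<Rightarrow> ('m \<Rightarrow> 'e) \<Rightarrow> 'm \<Rightarrow> 'e)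
      \<Rightarrow> ('m \<Rightarrow> 'e \<Rightarrow> 'e) \<Rightarrow> real \<Rightarrow> bool" where
  "complex_space_form A g nabla J c \<longleftrightarrow>
     kaehler A g nabla J \<and>
     (\<forall>U X. open U \<and> smooth_field A U X \<longrightarrow>
        (\<forall>p\<in>U. X p \<noteq> 0 \<longrightarrow> sectional_curvature A g nabla X (\<lambda>q. J q (X q)) p = c))"


section \<open>Submanifolds\<close>

definition isometric_immersion ::
    "('m::{t2_space,second_countable_topology}, 'e::euclidean_space) atlas
      \<Rightarrow> ('m \<Rightarrow> 'e \<Rightarrow> 'e \<Rightarrow> real)
      \<Rightarrow> ('n::{t2_space,second_countable_topology}, 'k::euclidean_space) atlas
      \<Rightarrow> ('n \<Rightarrow> 'k \<Rightarrow> 'k \<Rightarrow> real) \<Rightarrow> ('m \<Rightarrow> 'n) \<Rightarrow> bool" where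
  "isometric_immersion A g A' g' psi \<longleftrightarrow>
     smooth_map A A' psi \<and> (\<forall>p. inj (mdiff A A' psi p)) \<and>
     (\<forall>p u v. g' (psi p) (mdiff A A' psi p u) (mdiff A A' psi p v) = g p u v)"

text \<open>
  The connection \<open>\<nabla>'\<close> of the target, pulled back along \<open>psi\<close>, applied to a field \<open>V\<close> along \<open>psi\<close>
  (so \<open>V q\<close> is tangent to the target at \<open>psi q\<close>).  If \<open>V = \<Sum>\<^sub>b V\<^sup>b E\<^sub>b\<close>, where \<open>E\<^sub>b\<close> is the coordinate
  frame of the chart at \<open>psi p\<close>, then \<open>\<nabla>\<^sub>X V = \<Sum>\<^sub>b (X V\<^sup>b) E\<^sub>b + V\<^sup>b \<nabla>'\<^bsub>dpsi X\<^esub> E\<^sub>b\<close> at \<open>p\<close>.  In this chart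
  \<open>E\<^sub>b\<close> at \<open>psi p\<close> is the basis vector \<open>b\<close> itself.
\<close>

definition covderiv_along ::
    "('m, 'e::euclidean_space) atlas \<Rightarrow> ('n, 'k::euclidean_space) atlas
      \<Rightarrow> (('n \<Rightarrow> 'k) \<Rightarrow> ('n \<Rightarrow> 'k) \<Rightarrow> 'n \<Rightarrow> 'k) \<Rightarrow> ('m \<Rightarrow> 'n)
      \<Rightarrow> ('m \<Rightarrow> 'e) \<Rightarrow> ('m \<Rightarrow> 'k) \<Rightarrow> 'm \<Rightarrow> 'k" where
  "covderiv_along A A' nabla' psi X V p =
     (let c = chart_at A' (psi p)
      in vderiv A (\<lambda>q. vderiv A' (snd c) (psi q) (V q)) p (X p)
         + (\<Sum>b\<in>Basis. (V p \<bullet> b) *\<^sub>R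
              nabla' (coord_field A' c (mdiff A A' psi p (X p))) (coord_field A' c b) (psi p)))"

text \<open>The Gauss formula, solved for the second fundamental form.\<close>

definition second_fundamental_form ::
    "('m, 'e::euclidean_space) atlas \<Rightarrow> (('m \<Rightarrow> 'e) \<Rightarrow> ('m \<Rightarrow> 'e) \<Rightarrow> 'm \<Rightarrow> 'e)
      \<Rightarrow> ('n, 'k::euclidean_space) atlas \<Rightarrow> (('n \<Rightarrow> 'k) \<Rightarrow> ('n \<Rightarrow> 'k) \<Rightarrow> 'n \<Rightarrow> 'k) \<Rightarrow> ('m \<Rightarrow> 'n)
      \<Rightarrow> ('m \<Rightarrow> 'e) \<Rightarrow> ('m \<Rightarrow> 'e) \<Rightarrow> 'm \<Rightarrow> 'k" where
  "second_fundamental_form A nabla A' nabla' psi X Y p =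
     covderiv_along A A' nabla' psi X (\<lambda>q. mdiff A A' psi q (Y q)) p
     - mdiff A A' psi p (nabla X Y p)"

definition totally_geodesic ::
    "('m::{t2_space,second_countable_topology}, 'e::euclidean_space) atlas
      \<Rightarrow> (('m \<Rightarrow> 'e) \<Rightarrow> ('m \<Rightarrow> 'e) \<Rightarrow> 'm \<Rightarrow> 'e)
      \<Rightarrow> ('n, 'k::euclidean_space) atlas \<Rightarrow> (('n \<Rightarrow> 'k) \<Rightarrow> ('n \<Rightarrow> 'k) \<Rightarrow> 'n \<Rightarrow> 'k)
      \<Rightarrow> ('m \<Rightarrow> 'n) \<Rightarrow> bool" where
  "totally_geodesic A nabla A' nabla' psi \<longleftrightarrow>
     (\<forall>U X Y. open U \<and> smooth_field A U X \<and> smooth_field A U Y \<longrightarrow>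
        (\<forall>p\<in>U. second_fundamental_form A nabla A' nabla' psi X Y p = 0))"

definition complex_submanifold ::
    "('m, 'e::euclidean_space) atlas \<Rightarrow> ('n, 'k::euclidean_space) atlas
      \<Rightarrow> ('n \<Rightarrow> 'k \<Rightarrow> 'k) \<Rightarrow> ('m \<Rightarrow> 'n) \<Rightarrow> bool" where
  "complex_submanifold A A' J psi \<longleftrightarrow>
     (\<forall>p. J (psi p) ` range (mdiff A A' psi p) = range (mdiff A A' psi p))"

end

theory Submission
  imports Defs
begin

text \<open>
  Both factors are curves. On the base let \<open>e\<close> be a unit field; then \<open>\<nabla>\<^sub>e e = 0\<close>, so the Laplacian
  of \<open>f\<close> is \<open>- e (e f)\<close>. On the product let \<open>E\<close> be the lift of \<open>e\<close> and \<open>T\<close> the lift of a unit field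
  of the fibre, so that \<open>[E, T] = 0\<close> and \<open>|T| = f\<close>. Compatibility with the metric and vanishing torsion
  give \<open>\<nabla>\<^sub>E E = 0\<close>, \<open>\<nabla>\<^sub>E T = \<nabla>\<^sub>T E = (E f / f) T\<close> and \<open>\<nabla>\<^sub>T T = - f (E f) E\<close>, whence the Gauss
  curvature of the surface is \<open>- E (E f) / f\<close>, which is the Laplacian of \<open>f\<close> divided by \<open>f\<close>.

  On the other hand, a local left inverse of the immersion \<open>\<psi>\<close> extends every field on the surface to a
  \<open>\<psi>\<close>-related field of the ambient manifold. As \<open>\<psi>\<close> is totally geodesic, covariant derivatives of
  \<open>\<psi>\<close>-related fields are again \<open>\<psi>\<close>-related, hence so are curvatures. If \<open>X'\<close> extends \<open>E\<close>, then
  \<open>J X'\<close> is \<open>\<psi>\<close>-related to \<open>h T\<close> for a smooth \<open>h\<close> with \<open>h\<^sup>2 f\<^sup>2 = 1\<close>, because the surface is complex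
  and two-dimensional. So the Gauss curvature is the holomorphic sectional curvature \<open>c\<close>.
\<close>

section \<open>Smooth functions on open sets\<close>

text \<open>The curvature hypothesis speaks only of pairs \<open>X'\<close>, \<open>J X'\<close> of
  fields on an open subset of the ambient manifold, whereas the warped product is computed with
  fields on the surface. So \<open>J X'\<close> is formed on the ambient manifold and then
  identified along \<open>psi\<close>: there it is tangent to the surface, orthogonal to the image
  of \<open>E\<close> and of length 1. Whether \<open>h\<close> is \<open>1/f\<close> or
  \<open>-1/f\<close> depends on \<open>J\<close>; hence \<open>h\<close> is defined by an inner
  product, and the frame computation uses only \<open>h^2 f^2 = 1\<close>.

  Connections act on total functions while their axioms concern open sets, so all computations take
  place on a neighbourhood and rest on the locality of \<open>nabla\<close>. The extension of fields
  needs a left inverse of \<open>psi\<close> that is smooth, not merely differentiable; this comes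
  from the inverse function theorem by bootstrapping, with Cramer's rule for the inverse of the
  derivative.

  Two positive dimensions with sum 2 force \<open>m1 = 1\<close>, and the two inequalities amount to
  one equality.\<close>

declare Ck_on.simps(2) [simp del]

lemmas Ck_on_Suc_iff = Ck_on.simps(2)

lemma Ck_on_cong:
  assumes "open S" "\<And>x. x \<in> S \<Longrightarrow> f x = g x" "Ck_on k f S"
  shows "Ck_on k g S"
  using assms(2,3)
proof (induction k arbitrary: f g)
  case 0
  then show ?case using continuous_on_cong[of S S f g] by simp
next
  case (Suc k)
  have d: "(g has_derivative frechet_derivative f (at x)) (at x)" if "x \<in> S" for x
    using Suc.prems that assms(1) has_derivative_transform_within_open[of f _ x UNIV S g]
    by (auto simp: frechet_derivative_works[symmetric] Ck_on_Suc_iff)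
  have "Ck_on k (\<lambda>x. frechet_derivative g (at x) v) S" for v
    by (rule Suc.IH[of "\<lambda>x. frechet_derivative f (at x) v"])
      (use Suc.prems(2) frechet_derivative_at[OF d] in \<open>simp_all add: Ck_on_Suc_iff\<close>)
  then show ?case
    unfolding Ck_on_Suc_iff differentiable_def using d by blast
qed

text \<open>Lets an explicit formula for the derivative replace the chosen
  \<open>frechet_derivative\<close>; on an open set the two agree, because derivatives are
  unique.\<close>

lemma Ck_on_SucI:
  assumes "open S" "\<And>x. x \<in> S \<Longrightarrow> (f has_derivative f' x) (at x)" "\<And>v. Ck_on k (\<lambda>x. f' x v) S"
  shows "Ck_on (Suc k) f S"
proof -
  have "Ck_on k (\<lambda>x. frechet_derivative f (at x) v) S" for v
    by (rule Ck_on_cong[OF assms(1) _ assms(3)[of v]])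
      (use frechet_derivative_at[OF assms(2)] in simp)
  with assms(2) show ?thesis unfolding Ck_on_Suc_iff differentiable_def by blast
qed

lemma Ck_on_SucD:
  assumes "Ck_on (Suc k) f S" "x \<in> S"
  shows "(f has_derivative frechet_derivative f (at x)) (at x)"
  using assms by (auto simp: frechet_derivative_works[symmetric] Ck_on_Suc_iff)

lemma Ck_on_subset: "Ck_on k f S \<Longrightarrow> T \<subseteq> S \<Longrightarrow> Ck_on k f T"
  by (induction k arbitrary: f) (auto simp: Ck_on_Suc_iff intro: continuous_on_subset)

lemma Ck_on_Suc_imp: "Ck_on (Suc k) f S \<Longrightarrow> Ck_on k f S"
  by (induction k arbitrary: f)
    (auto simp: Ck_on_Suc_iff intro!: continuous_at_imp_continuous_on differentiable_imp_continuous_within)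

lemma Ck_on_local:
  assumes "\<And>x. x \<in> S \<Longrightarrow> \<exists>T. open T \<and> x \<in> T \<and> Ck_on k f (S \<inter> T)" "open S"
  shows "Ck_on k f S"
  using assms(1)
proof (induction k arbitrary: f)
  case 0
  have "continuous (at x) f" if x: "x \<in> S" for x
  proof -
    obtain T where "open T" "x \<in> T" "continuous_on (S \<inter> T) f"
      using 0[OF x] by auto
    then show ?thesis
      using continuous_on_eq_continuous_at[of "S \<inter> T" f] assms(2) x by auto
  qed
  then show ?case by (simp add: continuous_at_imp_continuous_on)
next
  case (Suc k)
  have "f differentiable (at x)" if "x \<in> S" for x
    using Suc.prems[OF that] that by (auto simp: Ck_on_Suc_iff)
  moreover have "Ck_on k (\<lambda>x. frechet_derivative f (at x) v) S" for v
    by (rule Suc.IH) (use Suc.prems in \<open>unfold Ck_on_Suc_iff, blast\<close>)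
  ultimately show ?case by (simp add: Ck_on_Suc_iff)
qed

section \<open>Closure properties of \<open>Ck_on\<close>\<close>

lemma Ck_on_const [simp]: "Ck_on k (\<lambda>x. a) S"
proof (induction k arbitrary: a)
  case (Suc k)
  then show ?case by (simp add: Ck_on_Suc_iff)
qed simp

lemma Ck_on_add:
  assumes "open S" "Ck_on k f S" "Ck_on k g S"
  shows "Ck_on k (\<lambda>x. f x + g x) S"
  using assms(2,3)
proof (induction k arbitrary: f g)
  case (Suc k)
  show ?case
    by (rule Ck_on_SucI[OF assms(1) has_derivative_add[OF Ck_on_SucD[OF Suc.prems(1)] Ck_on_SucD[OF Suc.prems(2)]]])
      (use Suc in \<open>auto simp: Ck_on_Suc_iff\<close>)
qed (auto intro: continuous_on_add)

text \<open>The product rule yields two terms of the same shape, each with one factor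
  differentiated, so the induction on the order runs over \<open>f\<close> and \<open>g\<close>
  simultaneously.\<close>

lemma Ck_on_bilinear:
  assumes "open S" "bounded_bilinear P" "Ck_on k f S" "Ck_on k g S"
  shows "Ck_on k (\<lambda>x. P (f x) (g x)) S"
  using assms(3,4)
proof (induction k arbitrary: f g)
  case 0
  then show ?case using bounded_bilinear.continuous_on[OF assms(2)] by auto
next
  case (Suc k)
  show ?case
  proof (rule Ck_on_SucI[OF assms(1)])
    fix x assume "x \<in> S"
    then show "((\<lambda>x. P (f x) (g x)) has_derivative
        (\<lambda>v. P (f x) (frechet_derivative g (at x) v) + P (frechet_derivative f (at x) v) (g x))) (at x)"
      using Suc.prems by (intro bounded_bilinear.FDERIV[OF assms(2)] Ck_on_SucD)
  next
    fix v
    show "Ck_on k (\<lambda>x. P (f x) (frechet_derivative g (at x) v)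
        + P (frechet_derivative f (at x) v) (g x)) S"
      using Suc.prems Ck_on_Suc_imp[OF Suc.prems(1)] Ck_on_Suc_imp[OF Suc.prems(2)]
      by (intro Ck_on_add assms(1) Suc.IH) (auto simp: Ck_on_Suc_iff)
  qed
qed

lemma Ck_on_linear_compose:
  assumes "open S" "bounded_linear L" "Ck_on k f S"
  shows "Ck_on k (\<lambda>x. L (f x)) S"
  using assms(3)
proof (induction k arbitrary: f)
  case 0
  then show ?case using bounded_linear.continuous_on[OF assms(2)] by auto
next
  case (Suc k)
  show ?case
    by (rule Ck_on_SucI[OF assms(1) bounded_linear.has_derivative[OF assms(2) Ck_on_SucD[OF Suc.prems]]])
      (use Suc in \<open>auto simp: Ck_on_Suc_iff\<close>)
qed

lemma Ck_on_sum:
  assumes "open S" "finite I" "\<And>i. i \<in> I \<Longrightarrow> Ck_on k (f i) S"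
  shows "Ck_on k (\<lambda>x. \<Sum>i\<in>I. f i x) S"
  using assms(2,3) by induction (auto intro: Ck_on_add[OF assms(1)])

text \<open>In the chain rule the direction \<open>Dg(x) v\<close> varies with \<open>x\<close>,
  while \<open>Ck_on\<close> controls derivatives of \<open>f\<close> only in fixed directions.
  Expanding this direction in the standard basis leaves products of real functions with the
  compositions of \<open>D_b f\<close> and \<open>g\<close>, to which the induction hypothesis
  applies.\<close>

lemma Ck_on_compose:
  fixes g :: "'a::euclidean_space \<Rightarrow> 'b::euclidean_space"
  assumes "open S" "open T" "g ` S \<subseteq> T" "Ck_on k f T" "Ck_on k g S"
  shows "Ck_on k (\<lambda>x. f (g x)) S"
  using assms(4,5)
proof (induction k arbitrary: f)
  case 0
  then show ?case using continuous_on_compose2[of T f S g] assms(3) by auto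
next
  case (Suc k)
  let ?D = frechet_derivative
  have exp: "?D f (at (g x)) w = (\<Sum>b\<in>Basis. (w \<bullet> b) *\<^sub>R ?D f (at (g x)) b)" if "x \<in> S" for x w
  proof -
    have "linear (?D f (at (g x)))"
      using Suc.prems(1) that assms(3) linear_frechet_derivative unfolding Ck_on_Suc_iff by blast
    then have "?D f (at (g x)) (\<Sum>b\<in>Basis. (w \<bullet> b) *\<^sub>R b) = (\<Sum>b\<in>Basis. (w \<bullet> b) *\<^sub>R ?D f (at (g x)) b)"
      by (simp add: linear_sum linear_scale)
    then show ?thesis by (simp add: euclidean_representation)
  qed
  show ?case
  proof (rule Ck_on_SucI[OF assms(1)])
    fix x assume x: "x \<in> S"
    show "((\<lambda>x. f (g x)) has_derivative
        (\<lambda>v. \<Sum>b\<in>Basis. (?D g (at x) v \<bullet> b) *\<^sub>R ?D f (at (g x)) b)) (at x)"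
      using has_derivative_compose[OF Ck_on_SucD[OF Suc.prems(2) x] Ck_on_SucD[OF Suc.prems(1)]]
        x assms(3) unfolding ext[OF exp[OF x, of "?D g (at x) _"], symmetric] by blast
  next
    fix v
    show "Ck_on k (\<lambda>x. \<Sum>b\<in>Basis. (?D g (at x) v \<bullet> b) *\<^sub>R ?D f (at (g x)) b) S"
      using Suc.prems Ck_on_Suc_imp[OF Suc.prems(2)]
      by (intro Ck_on_sum Ck_on_bilinear[OF assms(1) bounded_bilinear_scaleR]
          Ck_on_linear_compose[OF assms(1) bounded_linear_inner_left] Suc.IH assms(1)) (auto simp: Ck_on_Suc_iff)
  qed
qed

section \<open>Smooth functions on open subsets of a Euclidean space\<close>

lemma smooth_on_cong:
  "open S \<Longrightarrow> (\<And>x. x \<in> S \<Longrightarrow> f x = g x) \<Longrightarrow> smooth_on f S \<Longrightarrow> smooth_on g S"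
  unfolding smooth_on_def using Ck_on_cong by blast

lemma smooth_on_subset: "smooth_on f S \<Longrightarrow> T \<subseteq> S \<Longrightarrow> smooth_on f T"
  unfolding smooth_on_def using Ck_on_subset by blast

lemma smooth_on_local:
  assumes "open S" "\<And>x. x \<in> S \<Longrightarrow> \<exists>T. open T \<and> x \<in> T \<and> smooth_on f (S \<inter> T)"
  shows "smooth_on f S"
  unfolding smooth_on_def
proof
  fix k
  have "\<exists>T. open T \<and> x \<in> T \<and> Ck_on k f (S \<inter> T)" if "x \<in> S" for x
    using assms(2)[OF that] unfolding smooth_on_def by metis
  then show "Ck_on k f S"
    by (rule Ck_on_local[OF _ assms(1)])
qed

lemma smooth_on_const [simp]: "smooth_on (\<lambda>x. a) S"
  by (simp add: smooth_on_def)

lemma smooth_on_add: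
  "open S \<Longrightarrow> smooth_on f S \<Longrightarrow> smooth_on g S \<Longrightarrow> smooth_on (\<lambda>x. f x + g x) S"
  by (simp add: smooth_on_def Ck_on_add)

lemma smooth_on_sum:
  "open S \<Longrightarrow> finite I \<Longrightarrow> (\<And>i. i \<in> I \<Longrightarrow> smooth_on (f i) S) \<Longrightarrow> smooth_on (\<lambda>x. \<Sum>i\<in>I. f i x) S"
  by (simp add: smooth_on_def Ck_on_sum)

lemma smooth_on_scaleR:
  "open S \<Longrightarrow> smooth_on h S \<Longrightarrow> smooth_on f S \<Longrightarrow> smooth_on (\<lambda>x. h x *\<^sub>R f x) S"
  by (simp add: smooth_on_def Ck_on_bilinear[OF _ bounded_bilinear_scaleR])

lemma smooth_on_linear_compose:
  "open S \<Longrightarrow> bounded_linear L \<Longrightarrow> smooth_on f S \<Longrightarrow> smooth_on (\<lambda>x. L (f x)) S"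
  by (simp add: smooth_on_def Ck_on_linear_compose)

lemma smooth_on_compose:
  fixes g :: "'a::euclidean_space \<Rightarrow> 'b::euclidean_space"
  shows "open S \<Longrightarrow> open T \<Longrightarrow> g ` S \<subseteq> T \<Longrightarrow> smooth_on f T \<Longrightarrow> smooth_on g S
    \<Longrightarrow> smooth_on (\<lambda>x. f (g x)) S"
  by (simp add: smooth_on_def Ck_on_compose)

lemma smooth_on_linear:
  assumes "bounded_linear L"
  shows "smooth_on L S"
proof -
  have "Ck_on k L UNIV" for k
  proof (cases k)
    case 0
    then show ?thesis using assms by (simp add: linear_continuous_on)
  next
    case (Suc n)
    show ?thesis unfolding Suc
      by (rule Ck_on_SucI[OF open_UNIV bounded_linear_imp_has_derivative[OF assms]]) simp
  qed
  then show ?thesis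
    unfolding smooth_on_def using Ck_on_subset by blast
qed

lemma smooth_on_derivative:
  "smooth_on f S \<Longrightarrow> smooth_on (\<lambda>x. frechet_derivative f (at x) v) S"
  unfolding smooth_on_def by (metis Ck_on_Suc_iff)

lemma smooth_on_has_derivative:
  "smooth_on f S \<Longrightarrow> x \<in> S \<Longrightarrow> (f has_derivative frechet_derivative f (at x)) (at x)"
  unfolding smooth_on_def using Ck_on_SucD by blast

text \<open>Smoothness is known for fixed directions only, so the variable direction
  \<open>X x\<close> is expanded in the standard basis.\<close>

lemma smooth_on_derivative_apply:
  fixes f :: "'a::euclidean_space \<Rightarrow> 'v::real_normed_vector"
  assumes "open S" "smooth_on f S" "smooth_on X S"
  shows "smooth_on (\<lambda>x. frechet_derivative f (at x) (X x)) S"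
proof (rule smooth_on_cong[OF assms(1)])
  show "smooth_on (\<lambda>x. \<Sum>b\<in>Basis. (X x \<bullet> b) *\<^sub>R frechet_derivative f (at x) b) S"
    by (intro smooth_on_sum smooth_on_scaleR smooth_on_derivative assms
        smooth_on_linear_compose[OF assms(1) bounded_linear_inner_left] finite_Basis)
next
  fix x assume "x \<in> S"
  then have "linear (frechet_derivative f (at x))"
    using smooth_on_has_derivative[OF assms(2)] has_derivative_linear by blast
  then have "frechet_derivative f (at x) (\<Sum>b\<in>Basis. (X x \<bullet> b) *\<^sub>R b)
      = (\<Sum>b\<in>Basis. (X x \<bullet> b) *\<^sub>R frechet_derivative f (at x) b)"
    by (simp add: linear_sum linear_scale)
  then show "(\<Sum>b\<in>Basis. (X x \<bullet> b) *\<^sub>R frechet_derivative f (at x) b)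
      = frechet_derivative f (at x) (X x)"
    by (simp add: euclidean_representation)
qed

text \<open>Differentiation lowers the exponent by one, hence the induction is over all
  \<open>a\<close>. Reciprocals and inverse square roots are later written as powers to fall under
  this lemma.\<close>

lemma smooth_on_powr: "smooth_on (\<lambda>x::real. x powr a) {0<..}"
proof -
  have "Ck_on k (\<lambda>x::real. x powr a) {0<..}" for k
  proof (induction k arbitrary: a)
    case 0
    show ?case by (auto intro!: continuous_intros)
  next
    case (Suc k)
    show ?case
    proof (rule Ck_on_SucI[OF open_greaterThan])
      fix x :: real assume "x \<in> {0<..}"
      then show "((\<lambda>x. x powr a) has_derivative (\<lambda>v. (a * x powr (a - 1)) * v)) (at x)"
        using has_real_derivative_powr[of x a]
        by (simp add: has_field_derivative_def)
    next
      fix v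
      show "Ck_on k (\<lambda>x. a * x powr (a - 1) * v) {0<..}"
        using Ck_on_linear_compose[OF open_greaterThan _ Suc.IH[of "a-1"], of "\<lambda>t. a * t * v"]
        by (simp add: bounded_linear_mult_left bounded_linear_const_mult bounded_linear_mult_const)
    qed
  qed
  then show ?thesis by (simp add: smooth_on_def)
qed

lemma smooth_on_powr_compose:
  fixes h :: "'a::euclidean_space \<Rightarrow> real"
  shows "open S \<Longrightarrow> smooth_on h S \<Longrightarrow> (\<And>x. x \<in> S \<Longrightarrow> h x > 0) \<Longrightarrow> smooth_on (\<lambda>x. h x powr a) S"
  by (rule smooth_on_compose[where T = "{0<..}" and f = "\<lambda>x::real. x powr a"])
    (auto intro: smooth_on_powr)

lemma smooth_on_mult:
  fixes f g :: "_ \<Rightarrow> real"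
  shows "open S \<Longrightarrow> smooth_on f S \<Longrightarrow> smooth_on g S \<Longrightarrow> smooth_on (\<lambda>x. f x * g x) S"
  using smooth_on_scaleR[of S f g] by simp

lemma smooth_on_diff:
  assumes "open S" "smooth_on f S" "smooth_on g S"
  shows "smooth_on (\<lambda>x. f x - g x) S"
  using smooth_on_add[OF assms(1,2) smooth_on_scaleR[OF assms(1) smooth_on_const[of "-1"] assms(3)]]
  by simp

lemma smooth_on_inner_const:
  assumes "open S" "smooth_on f S"
  shows "smooth_on (\<lambda>x. f x \<bullet> b) S"
  by (rule smooth_on_linear_compose[OF assms(1) bounded_linear_inner_left assms(2)])

section \<open>Matrix inversion and the smooth inverse function theorem in dimension 2\<close>

lemma inv_linear_dim2:
  fixes L :: "'a::euclidean_space \<Rightarrow> 'a"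
  assumes B: "Basis = {i, j}" "i \<noteq> (j::'a)" and L: "linear L" "bij L"
  defines "d \<equiv> (L i \<bullet> i) * (L j \<bullet> j) - (L i \<bullet> j) * (L j \<bullet> i)"
  shows "d \<noteq> 0"
    and "inv L w = (1 / d) *\<^sub>R (((w \<bullet> i) * (L j \<bullet> j) - (w \<bullet> j) * (L j \<bullet> i)) *\<^sub>R i
      + ((w \<bullet> j) * (L i \<bullet> i) - (w \<bullet> i) * (L i \<bullet> j)) *\<^sub>R j)"
proof -
  have ij: "i \<bullet> i = 1" "j \<bullet> j = 1" "i \<bullet> j = 0" "j \<bullet> i = 0"
    using B(2) inner_same_Basis[of i] inner_same_Basis[of j] inner_not_same_Basis[of i j]
      inner_not_same_Basis[of j i] unfolding B(1) by simp_all
  have eqI: "u = v" if "u \<bullet> i = v \<bullet> i" "u \<bullet> j = v \<bullet> j" for u v :: 'a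
    using that B by (intro euclidean_eqI[of u v]) auto
  have Lc: "L (a *\<^sub>R i + b *\<^sub>R j) = a *\<^sub>R L i + b *\<^sub>R L j" for a b
    by (simp add: L(1) linear_add linear_scale)
  have inj: "v = 0" if "L v = 0" for v
    using L that by (metis bij_is_inj injD linear_0)
  show d: "d \<noteq> 0"
  proof
    assume "d = 0"
    then have eq: "(L i \<bullet> i) * (L j \<bullet> j) = (L i \<bullet> j) * (L j \<bullet> i)" by (simp add: d_def)
    \<comment> \<open>If the determinant vanishes, the columns of the adjugate matrix lie in the
      kernel. Injectivity makes their entries zero, which forces \<open>L j = 0\<close>.\<close>
    have "L ((L j \<bullet> j) *\<^sub>R i + (- (L i \<bullet> j)) *\<^sub>R j) = 0"
      unfolding Lc by (rule eqI) (simp_all add: inner_simps eq algebra_simps)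
    then have "(L j \<bullet> j) *\<^sub>R i + (- (L i \<bullet> j)) *\<^sub>R j = 0" by (rule inj)
    then have "((L j \<bullet> j) *\<^sub>R i + (- (L i \<bullet> j)) *\<^sub>R j) \<bullet> i = 0" by simp
    then have a: "L j \<bullet> j = 0" by (simp add: inner_simps ij)
    have "L ((L j \<bullet> i) *\<^sub>R i + (- (L i \<bullet> i)) *\<^sub>R j) = 0"
      unfolding Lc by (rule eqI) (use eq in \<open>simp_all add: inner_simps algebra_simps\<close>)
    then have "(L j \<bullet> i) *\<^sub>R i + (- (L i \<bullet> i)) *\<^sub>R j = 0" by (rule inj)
    then have "((L j \<bullet> i) *\<^sub>R i + (- (L i \<bullet> i)) *\<^sub>R j) \<bullet> i = 0" by simp
    then have "L j \<bullet> i = 0" by (simp add: inner_simps ij)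
    with a have "L j = 0" by (intro eqI) auto
    then have "j = 0" by (rule inj)
    with ij show False by simp
  qed
  let ?v = "(1 / d) *\<^sub>R (((w \<bullet> i) * (L j \<bullet> j) - (w \<bullet> j) * (L j \<bullet> i)) *\<^sub>R i
      + ((w \<bullet> j) * (L i \<bullet> i) - (w \<bullet> i) * (L i \<bullet> j)) *\<^sub>R j)"
  have dv: "d *\<^sub>R ?v = ((w \<bullet> i) * (L j \<bullet> j) - (w \<bullet> j) * (L j \<bullet> i)) *\<^sub>R i
      + ((w \<bullet> j) * (L i \<bullet> i) - (w \<bullet> i) * (L i \<bullet> j)) *\<^sub>R j"
    using d by simp
  have "d *\<^sub>R L ?v = d *\<^sub>R w"
    unfolding linear_scale[OF L(1), symmetric] unfolding dv unfolding Lc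
    by (rule eqI) (simp_all add: inner_simps d_def algebra_simps)
  then have "L ?v = w" using d by simp
  then show "inv L w = ?v" using L(2) by (metis bij_is_inj inv_f_f)
qed

lemma smooth_on_inv_linear:
  fixes L :: "'b::euclidean_space \<Rightarrow> 'a::euclidean_space \<Rightarrow> 'a"
  assumes "DIM('a) = 2" "open S" "\<And>v. smooth_on (\<lambda>x. L x v) S"
    and "\<And>x. x \<in> S \<Longrightarrow> linear (L x)" "\<And>x. x \<in> S \<Longrightarrow> bij (L x)"
  shows "smooth_on (\<lambda>x. inv (L x) w) S"
proof -
  obtain i j :: 'a where B: "Basis = {i, j}" "i \<noteq> j"
    using assms(1) unfolding card_2_iff by blast
  define d where "d x = (L x i \<bullet> i) * (L x j \<bullet> j) - (L x i \<bullet> j) * (L x j \<bullet> i)" for x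
  have d: "smooth_on d S"
    unfolding d_def by (intro smooth_on_diff smooth_on_mult smooth_on_inner_const assms)
  \<comment> \<open>The scalar factor is \<open>1 / d x\<close>. The determinant may be negative, so
    only its square is put under \<open>powr\<close>.\<close>
  have "smooth_on (\<lambda>x. (d x * (d x * d x) powr (-1)) *\<^sub>R
      (((w \<bullet> i) * (L x j \<bullet> j) - (w \<bullet> j) * (L x j \<bullet> i)) *\<^sub>R i
      + ((w \<bullet> j) * (L x i \<bullet> i) - (w \<bullet> i) * (L x i \<bullet> j)) *\<^sub>R j)) S"
    using inv_linear_dim2(1)[OF B assms(4,5)] zero_less_mult_iff
    by (intro smooth_on_diff smooth_on_mult smooth_on_inner_const smooth_on_scaleR smooth_on_add d
        smooth_on_const smooth_on_powr_compose assms) (auto simp: d_def linorder_neq_iff zero_less_mult_iff)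
  then show ?thesis
  proof (rule smooth_on_cong[OF assms(2), rotated])
    fix x assume x: "x \<in> S"
    have "d x \<noteq> 0" using inv_linear_dim2(1)[OF B assms(4,5)[OF x]] by (simp add: d_def)
    then have "d x * (d x * d x) powr (-1) = 1 / d x"
      by (simp add: powr_minus field_simps)
    then show "(d x * (d x * d x) powr (-1)) *\<^sub>R
        (((w \<bullet> i) * (L x j \<bullet> j) - (w \<bullet> j) * (L x j \<bullet> i)) *\<^sub>R i
        + ((w \<bullet> j) * (L x i \<bullet> i) - (w \<bullet> i) * (L x i \<bullet> j)) *\<^sub>R j) = inv (L x) w"
      unfolding inv_linear_dim2(2)[OF B assms(4,5)[OF x]] by (simp add: d_def)
  qed
qed

text \<open>Bootstrapping: the derivative of the local inverse \<open>h\<close> at \<open>y\<close>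
  is the inverse of the derivative of \<open>G\<close> at \<open>h y\<close>. If \<open>h\<close> is
  \<open>k\<close> times continuously differentiable, then so is this derivative, and
  \<open>h\<close> gains one order. Dimension 2 enters through the smoothness of matrix
  inversion.\<close>

lemma smooth_inverse_function:
  fixes G :: "'a::euclidean_space \<Rightarrow> 'a"
  assumes "DIM('a) = 2" "open Q" "smooth_on G Q" "z0 \<in> Q" "bij (frechet_derivative G (at z0))"
  obtains U V h where "open U" "U \<subseteq> Q" "z0 \<in> U" "open V" "homeomorphism U V G h" "smooth_on h V"
proof -
  define F where "F x = Blinfun (frechet_derivative G (at x))" for x
  have F: "blinfun_apply (F x) = frechet_derivative G (at x)" if "x \<in> Q" for x
    using smooth_on_has_derivative[OF assms(3) that] has_derivative_bounded_linear
    unfolding F_def by (auto simp: bounded_linear_Blinfun_apply)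
  have lin: "linear (frechet_derivative G (at x))" if "x \<in> Q" for x
    using smooth_on_has_derivative[OF assms(3) that] has_derivative_linear by blast
  have smF: "smooth_on (\<lambda>x. frechet_derivative G (at x) v) Q" for v
    by (rule smooth_on_derivative[OF assms(3)])
  have der: "(G has_derivative blinfun_apply (F x)) (at x)" if "x \<in> Q" for x
    using smooth_on_has_derivative[OF assms(3) that] F[OF that] by simp
  \<comment> \<open>The inverse function theorem asks for a derivative that is continuous as a map
    into bounded operators; in finite dimension it suffices to test this on fixed vectors.\<close>
  have cont: "continuous_on Q F"
  proof (rule continuous_on_blinfun_componentwise)
    fix i
    have "Ck_on 0 (\<lambda>x. frechet_derivative G (at x) i) Q"
      using smF unfolding smooth_on_def by blast
    then have "continuous_on Q (\<lambda>x. frechet_derivative G (at x) i)" by simp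
    then show "continuous_on Q (\<lambda>x. blinfun_apply (F x) i)"
      by (rule continuous_on_eq) (simp add: F)
  qed
  let ?L = "frechet_derivative G (at z0)"
  have bl: "bounded_linear (inv ?L)"
    using assms(5) lin[OF assms(4)] inj_linear_imp_inv_linear[of ?L] 
    by (auto simp: bij_is_inj linear_conv_bounded_linear)
  have inv: "Blinfun (inv ?L) o\<^sub>L F z0 = id_blinfun"
    using assms(5) by (intro blinfun_eqI) (simp add: bounded_linear_Blinfun_apply[OF bl] F[OF assms(4)] bij_is_inj)
  obtain U V h h' where UV: "open U" "U \<subseteq> Q" "z0 \<in> U" "open V" and "G z0 \<in> V" and hom: "homeomorphism U V G h"
    and h: "\<And>y. y \<in> V \<Longrightarrow> (h has_derivative (h' y)) (at y)"
      "\<And>y. y \<in> V \<Longrightarrow> h' y = inv (blinfun_apply (F (h y)))"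
      "\<And>y. y \<in> V \<Longrightarrow> bij (blinfun_apply (F (h y)))"
    using inverse_function_theorem[OF assms(2) der cont assms(4) inv] by (smt (verit) that)
  have hV: "h y \<in> U" if "y \<in> V" for y
    using hom that by (auto simp: homeomorphism_def)
  have bij: "bij (frechet_derivative G (at x))" if "x \<in> U" for x
  proof -
    have "G x \<in> V" "h (G x) = x" using hom that by (auto simp: homeomorphism_def)
    then show ?thesis using h(3)[of "G x"] F[of x] that UV(2) by auto
  qed
  have K: "smooth_on (\<lambda>x. inv (frechet_derivative G (at x)) w) U" for w
    by (rule smooth_on_inv_linear[OF assms(1) UV(1) smooth_on_subset[OF smF UV(2)]])
      (use lin bij UV(2) in auto)
  have "Ck_on k h V" for k
  proof (induction k)
    case 0
    show ?case using hom by (simp add: homeomorphism_def)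
  next
    case (Suc k)
    show ?case
    proof (rule Ck_on_SucI[OF UV(4)])
      fix y assume y: "y \<in> V"
      show "(h has_derivative (\<lambda>v. inv (frechet_derivative G (at (h y))) v)) (at y)"
        using h(1,2)[OF y] F[of "h y"] hV[OF y] UV(2) by auto
    next
      fix v
      show "Ck_on k (\<lambda>y. inv (frechet_derivative G (at (h y))) v) V"
        by (rule Ck_on_compose[OF UV(4,1) _ _ Suc, of "\<lambda>x. inv (frechet_derivative G (at x)) v"])
          (use hV K in \<open>auto simp: smooth_on_def\<close>)
    qed
  qed
  then show ?thesis
    by (intro that[OF UV(1-4) hom]) (simp add: smooth_on_def)
qed

section \<open>Derivatives in charts\<close>

lemma chart_at:
  assumes "smooth_atlas A"
  shows "chart_at A p \<in> A" "p \<in> fst (chart_at A p)"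
proof -
  have "p \<in> (\<Union>c\<in>A. fst c)" using assms unfolding smooth_atlas_def by simp
  then have "\<exists>c. c \<in> A \<and> p \<in> fst c" by blast
  then show "chart_at A p \<in> A" "p \<in> fst (chart_at A p)"
    unfolding chart_at_def by (metis (mono_tags, lifting) someI_ex)+
qed

context
  fixes A :: "('m::{t2_space,second_countable_topology}, 'e::euclidean_space) atlas" and c
  assumes A: "smooth_atlas A" and c: "c \<in> A"
begin

lemma chart_homeomorphism: "homeomorphism (fst c) (snd c ` fst c) (snd c) (chart_inv c)"
  using A c unfolding smooth_atlas_def by blast

lemma chart_open: "open (fst c)" "open (snd c ` fst c)"
  using A c unfolding smooth_atlas_def by blast+

lemma chart_inv_chart [simp]: "q \<in> fst c \<Longrightarrow> chart_inv c (snd c q) = q"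
  using chart_homeomorphism unfolding homeomorphism_def by blast

lemma chart_image_open: "open U \<Longrightarrow> U \<subseteq> fst c \<Longrightarrow> open (snd c ` U)"
  using homeomorphism_imp_open_map[OF chart_homeomorphism, of U] chart_open
  by (simp add: openin_open_eq)

lemma chart_image_open': "open U \<Longrightarrow> open (snd c ` (fst c \<inter> U))"
  using chart_image_open chart_open(1) by blast

lemma chart_vimage_open:
  assumes "open V" shows "open (fst c \<inter> snd c -` V)"
  by (rule continuous_open_preimage[OF homeomorphism_cont1[OF chart_homeomorphism] chart_open(1) assms])

lemma transition_smooth:
  "c' \<in> A \<Longrightarrow> smooth_on (snd c' \<circ> chart_inv c) (snd c ` (fst c \<inter> fst c'))"
  using A c unfolding smooth_atlas_def by blast

end

text \<open>Near \<open>p\<close> the map \<open>f\<close> read in \<open>c'\<close> is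
  \<open>f\<close> read in \<open>c\<close> after the transition map, which is smooth; so this is
  the chain rule.\<close>

lemma chart_change:
  fixes A :: "('m::{t2_space,second_countable_topology}, 'e::euclidean_space) atlas"
    and f :: "'m \<Rightarrow> 'v::real_normed_vector"
  assumes A: "smooth_atlas A" and c: "c \<in> A" "p \<in> fst c" and c': "c' \<in> A" "p \<in> fst c'"
    and f: "((f \<circ> chart_inv c) has_derivative D) (at (snd c p))"
  shows "((f \<circ> chart_inv c') has_derivative
    (\<lambda>v. D (frechet_derivative (snd c \<circ> chart_inv c') (at (snd c' p)) v))) (at (snd c' p))"
proof -
  let ?T = "snd c \<circ> chart_inv c'"
  let ?S = "snd c' ` (fst c' \<inter> fst c)"
  have S: "open ?S" "snd c' p \<in> ?S"
    using chart_image_open'[OF A c'(1) chart_open(1)[OF A c(1)]] c c' by auto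
  have T: "(?T has_derivative frechet_derivative ?T (at (snd c' p))) (at (snd c' p))"
    using smooth_on_has_derivative[OF transition_smooth[OF A c'(1) c(1)] S(2)] .
  have "?T (snd c' p) = snd c p" using chart_inv_chart[OF A c'] by simp
  then have "((\<lambda>z. (f \<circ> chart_inv c) (?T z)) has_derivative
      (\<lambda>v. D (frechet_derivative ?T (at (snd c' p)) v))) (at (snd c' p))"
    using has_derivative_compose[OF T] f by metis
  then show ?thesis
    by (rule has_derivative_transform_within_open[OF _ S])
      (use chart_inv_chart[OF A c'(1)] chart_inv_chart[OF A c(1)] in auto)
qed

text \<open>Since \<open>vderiv\<close> is a total function built on
  \<open>frechet_derivative\<close>, its calculus rules need a separate differentiability condition.
  The fixed chart is used so that \<open>vderiv\<close> itself is the derivative in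
  question.\<close>

definition mfd_differentiable ::
    "('m, 'e::euclidean_space) atlas \<Rightarrow> ('m \<Rightarrow> 'v::real_normed_vector) \<Rightarrow> 'm \<Rightarrow> bool" where
  "mfd_differentiable A f p \<longleftrightarrow>
     (f \<circ> chart_inv (chart_at A p)) differentiable (at (snd (chart_at A p) p))"

lemma vderiv_has_derivative:
  "mfd_differentiable A f p \<longleftrightarrow>
    ((f \<circ> chart_inv (chart_at A p)) has_derivative vderiv A f p) (at (snd (chart_at A p) p))"
  unfolding mfd_differentiable_def vderiv_def frechet_derivative_works by simp

lemma vderivI:
  assumes "((f \<circ> chart_inv (chart_at A p)) has_derivative D) (at (snd (chart_at A p) p))"
  shows "mfd_differentiable A f p" "vderiv A f p = D"
  using assms frechet_derivative_at[OF assms]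
  unfolding mfd_differentiable_def vderiv_def differentiable_def by auto

lemma linear_vderiv: "mfd_differentiable A f p \<Longrightarrow> linear (vderiv A f p)"
  unfolding vderiv_has_derivative by (rule has_derivative_linear)

section \<open>Calculus with \<open>vderiv\<close> on one manifold\<close>

context
  fixes A :: "('m::{t2_space,second_countable_topology}, 'e::euclidean_space) atlas"
  assumes A: "smooth_atlas A"
begin

lemma vderiv_cong:
  assumes "open U" "p \<in> U" "\<And>q. q \<in> U \<Longrightarrow> f q = g q" "mfd_differentiable A f p"
  shows "mfd_differentiable A g p" "vderiv A f p = vderiv A g p"
proof -
  let ?c = "chart_at A p"
  note c = chart_at[OF A, of p]
  have "((g \<circ> chart_inv ?c) has_derivative vderiv A f p) (at (snd ?c p))"
    using assms(4) unfolding vderiv_has_derivative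
    by (rule has_derivative_transform_within_open[OF _ chart_image_open'[OF A c(1) assms(1)]])
      (use c assms in \<open>auto simp: chart_inv_chart[OF A c(1)]\<close>)
  from vderivI[OF this] show "mfd_differentiable A g p" "vderiv A f p = vderiv A g p" by auto
qed

lemma mfd_differentiable_chart:
  assumes "c \<in> A" "p \<in> fst c" "((f \<circ> chart_inv c) has_derivative D) (at (snd c p))"
  shows "mfd_differentiable A f p" "vderiv A f p v = D (vderiv A (snd c) p v)"
  using vderivI[OF chart_change[OF A assms(1,2) chart_at[OF A] assms(3)]]
  by (simp_all add: vderiv_def)

lemma smooth_fun_mfd_differentiable:
  assumes "smooth_fun A U f" "p \<in> U"
  shows "mfd_differentiable A f p"
proof -
  note c = chart_at[OF A, of p]
  have "smooth_on (f \<circ> chart_inv (chart_at A p)) (snd (chart_at A p) ` (fst (chart_at A p) \<inter> U))"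
    using assms c unfolding smooth_fun_def by blast
  from smooth_on_has_derivative[OF this, of "snd (chart_at A p) p"] show ?thesis
    using vderivI c assms(2) by (metis IntI imageI)
qed

lemma vderiv_chart:
  assumes "c \<in> A" "p \<in> fst c" "mfd_differentiable A f p"
  shows "vderiv A f p v = frechet_derivative (f \<circ> chart_inv c) (at (snd c p)) (vderiv A (snd c) p v)"
proof -
  have "(f \<circ> chart_inv c) differentiable at (snd c p)"
    using chart_change[OF A chart_at[OF A] assms(1,2)] assms(3)
    unfolding vderiv_has_derivative differentiable_def by blast
  then show ?thesis
    using mfd_differentiable_chart(2)[OF assms(1,2)] frechet_derivative_works by blast
qed

lemma chart_has_derivative_id:
  assumes "c \<in> A" "p \<in> fst c"
  shows "((snd c \<circ> chart_inv c) has_derivative (\<lambda>v. v)) (at (snd c p))"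
  by (rule has_derivative_transform_within_open[OF has_derivative_ident chart_open(2)[OF A assms(1)]])
    (use assms in \<open>auto simp: chart_inv_chart[OF A assms(1)]\<close>)

lemma vderiv_chart_at [simp]: "vderiv A (snd (chart_at A p)) p v = v"
  using vderivI(2)[OF chart_has_derivative_id[OF chart_at[OF A]]] by simp

lemma mfd_differentiable_snd: "c \<in> A \<Longrightarrow> p \<in> fst c \<Longrightarrow> mfd_differentiable A (snd c) p"
  using mfd_differentiable_chart(1)[OF _ _ chart_has_derivative_id] .

text \<open>A left inverse is the derivative of the fixed chart at \<open>p\<close> read in
  \<open>c\<close>, because the fixed chart has the identity as its differential. In equal finite
  dimensions injectivity is enough.\<close>

lemma bij_vderiv_chart:
  assumes "c \<in> A" "p \<in> fst c"
  shows "bij (vderiv A (snd c) p)"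
proof -
  have lin: "linear (vderiv A (snd c) p)"
    using linear_vderiv[OF mfd_differentiable_snd[OF assms]] .
  have "inj (vderiv A (snd c) p)"
    using vderiv_chart[OF assms mfd_differentiable_snd[OF chart_at[OF A, of p]]]
    unfolding vderiv_chart_at by (metis injI)
  then show ?thesis
    using lin by (simp add: bij_def linear_injective_imp_surjective)
qed

lemma coord_field:
  assumes "c \<in> A" "p \<in> fst c"
  shows "vderiv A (snd c) p (coord_field A c w p) = w"
    "coord_field A c (vderiv A (snd c) p v) p = v"
  using bij_vderiv_chart[OF assms] unfolding coord_field_def
  by (auto simp: bij_is_surj bij_is_inj surj_f_inv_f)

lemma coord_field_chart_at [simp]: "coord_field A (chart_at A p) w p = w"
  using coord_field(2)[OF chart_at[OF A, of p], of w] by simp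

lemma linear_coord_field:
  assumes "c \<in> A" "p \<in> fst c"
  shows "linear (\<lambda>w. coord_field A c w p)"
  using inj_linear_imp_inv_linear[OF linear_vderiv[OF mfd_differentiable_snd[OF assms]]]
    bij_is_inj[OF bij_vderiv_chart[OF assms]]
  unfolding coord_field_def by simp

lemma vderiv_const [simp]: "mfd_differentiable A (\<lambda>q. a) p" "vderiv A (\<lambda>q. a) p v = 0"
proof -
  have "(((\<lambda>q. a) \<circ> chart_inv (chart_at A p)) has_derivative (\<lambda>v. 0)) (at (snd (chart_at A p) p))"
    by (simp add: comp_def)
  from vderivI[OF this] show "mfd_differentiable A (\<lambda>q. a) p" "vderiv A (\<lambda>q. a) p v = 0" by auto
qed

lemma vderiv_linear_compose:
  assumes "bounded_linear L" "mfd_differentiable A f p"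
  shows "mfd_differentiable A (\<lambda>q. L (f q)) p" "vderiv A (\<lambda>q. L (f q)) p v = L (vderiv A f p v)"
proof -
  have "(((\<lambda>q. L (f q)) \<circ> chart_inv (chart_at A p)) has_derivative
      (\<lambda>v. L (vderiv A f p v))) (at (snd (chart_at A p) p))"
    using bounded_linear.has_derivative[OF assms(1) assms(2)[unfolded vderiv_has_derivative]]
    by (simp add: comp_def)
  from vderivI[OF this] show "mfd_differentiable A (\<lambda>q. L (f q)) p"
    "vderiv A (\<lambda>q. L (f q)) p v = L (vderiv A f p v)" by auto
qed

lemma vderiv_scaleR:
  assumes "mfd_differentiable A h p" "mfd_differentiable A f p"
  shows "mfd_differentiable A (\<lambda>q. h q *\<^sub>R f q) p"
    "vderiv A (\<lambda>q. h q *\<^sub>R f q) p v = vderiv A h p v *\<^sub>R f p + h p *\<^sub>R vderiv A f p v"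
proof -
  note c = chart_at[OF A, of p]
  have "(((\<lambda>q. h q *\<^sub>R f q) \<circ> chart_inv (chart_at A p)) has_derivative
      (\<lambda>v. h p *\<^sub>R vderiv A f p v + vderiv A h p v *\<^sub>R f p)) (at (snd (chart_at A p) p))"
    using has_derivative_scaleR[OF assms[unfolded vderiv_has_derivative]] chart_inv_chart[OF A c]
    by (simp add: comp_def)
  from vderivI[OF this] show "mfd_differentiable A (\<lambda>q. h q *\<^sub>R f q) p"
    "vderiv A (\<lambda>q. h q *\<^sub>R f q) p v = vderiv A h p v *\<^sub>R f p + h p *\<^sub>R vderiv A f p v" by auto
qed

lemma vderiv_mult:
  fixes h f :: "'m \<Rightarrow> real"
  assumes "mfd_differentiable A h p" "mfd_differentiable A f p"
  shows "vderiv A (\<lambda>q. h q * f q) p v = vderiv A h p v * f p + h p * vderiv A f p v"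
  using vderiv_scaleR(2)[OF assms] by simp

section \<open>Smooth functions on open subsets of a manifold\<close>

lemma smooth_fun_subset: "smooth_fun A U f \<Longrightarrow> V \<subseteq> U \<Longrightarrow> smooth_fun A V f"
  unfolding smooth_fun_def by (meson Int_mono image_mono order_refl smooth_on_subset)

lemma smooth_fun_cong:
  assumes "open U" "\<And>q. q \<in> U \<Longrightarrow> f q = g q" "smooth_fun A U f"
  shows "smooth_fun A U g"
  unfolding smooth_fun_def
proof
  fix c assume c: "c \<in> A"
  show "smooth_on (g \<circ> chart_inv c) (snd c ` (fst c \<inter> U))"
    by (rule smooth_on_cong[OF chart_image_open'[OF A c assms(1)], of "f \<circ> chart_inv c"])
      (use assms c in \<open>auto simp: smooth_fun_def chart_inv_chart[OF A c]\<close>)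
qed

lemma smooth_fun_local:
  assumes "open U" "\<And>p. p \<in> U \<Longrightarrow> \<exists>V. open V \<and> p \<in> V \<and> smooth_fun A (U \<inter> V) f"
  shows "smooth_fun A U f"
  unfolding smooth_fun_def
proof
  fix c assume c: "c \<in> A"
  show "smooth_on (f \<circ> chart_inv c) (snd c ` (fst c \<inter> U))"
  proof (rule smooth_on_local[OF chart_image_open'[OF A c assms(1)]])
    fix z assume "z \<in> snd c ` (fst c \<inter> U)"
    then obtain p where p: "p \<in> fst c" "p \<in> U" "z = snd c p" by auto
    obtain V where V: "open V" "p \<in> V" "smooth_fun A (U \<inter> V) f" using assms(2) p by blast
    have "smooth_on (f \<circ> chart_inv c) (snd c ` (fst c \<inter> (U \<inter> V)))"
      using V(3) c unfolding smooth_fun_def by blast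
    then have "smooth_on (f \<circ> chart_inv c) (snd c ` (fst c \<inter> U) \<inter> snd c ` (fst c \<inter> V))"
      by (rule smooth_on_subset) (auto, metis IntI chart_inv_chart[OF A c] imageI)
    then show "\<exists>T. open T \<and> z \<in> T \<and> smooth_on (f \<circ> chart_inv c) (snd c ` (fst c \<inter> U) \<inter> T)"
      using chart_image_open'[OF A c V(1)] p V(2) by blast
  qed
qed

text \<open>One chart covering \<open>U\<close> suffices, since every other chart differs from it by
  a smooth transition map.\<close>

lemma smooth_fun_chartI:
  assumes "c \<in> A" "open U" "U \<subseteq> fst c" "smooth_on (f \<circ> chart_inv c) (snd c ` U)"
  shows "smooth_fun A U f"
  unfolding smooth_fun_def
proof
  fix c' assume c': "c' \<in> A"
  have 1: "smooth_on (snd c \<circ> chart_inv c') (snd c' ` (fst c' \<inter> U))"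
    by (rule smooth_on_subset[OF transition_smooth[OF A c' assms(1)]]) (use assms in auto)
  have "smooth_on (\<lambda>z. (f \<circ> chart_inv c) ((snd c \<circ> chart_inv c') z)) (snd c' ` (fst c' \<inter> U))"
    by (rule smooth_on_compose[OF chart_image_open'[OF A c' assms(2)]
          chart_image_open[OF A assms(1,2,3)] _ assms(4) 1])
      (auto simp: chart_inv_chart[OF A c'])
  then show "smooth_on (f \<circ> chart_inv c') (snd c' ` (fst c' \<inter> U))"
    by (rule smooth_on_cong[OF chart_image_open'[OF A c' assms(2)], rotated])
      (use assms in \<open>auto simp: chart_inv_chart[OF A c'] chart_inv_chart[OF A assms(1)]\<close>)
qed

lemma smooth_fun_chartD:
  assumes "smooth_fun A U f" "c \<in> A" "U \<subseteq> fst c"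
  shows "smooth_on (f \<circ> chart_inv c) (snd c ` U)"
proof -
  have "fst c \<inter> U = U" using assms(3) by blast
  then show ?thesis using assms(1,2) unfolding smooth_fun_def by metis
qed

lemma smooth_fun_const [simp]: "smooth_fun A U (\<lambda>q. a)"
  unfolding smooth_fun_def by (simp add: comp_def)

lemma smooth_fun_add:
  assumes "open U" "smooth_fun A U f" "smooth_fun A U g"
  shows "smooth_fun A U (\<lambda>q. f q + g q)"
  unfolding smooth_fun_def
proof
  fix c assume c: "c \<in> A"
  show "smooth_on ((\<lambda>q. f q + g q) \<circ> chart_inv c) (snd c ` (fst c \<inter> U))"
    using smooth_on_add[OF chart_image_open'[OF A c assms(1)], of "f \<circ> chart_inv c" "g \<circ> chart_inv c"]
      assms(2,3) c unfolding smooth_fun_def by (simp add: comp_def)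
qed

lemma smooth_fun_scaleR:
  assumes "open U" "smooth_fun A U h" "smooth_fun A U f"
  shows "smooth_fun A U (\<lambda>q. h q *\<^sub>R f q)"
  unfolding smooth_fun_def
proof
  fix c assume c: "c \<in> A"
  show "smooth_on ((\<lambda>q. h q *\<^sub>R f q) \<circ> chart_inv c) (snd c ` (fst c \<inter> U))"
    using smooth_on_scaleR[OF chart_image_open'[OF A c assms(1)], of "h \<circ> chart_inv c" "f \<circ> chart_inv c"]
      assms(2,3) c unfolding smooth_fun_def by (simp add: comp_def)
qed

lemma smooth_fun_linear_compose:
  assumes "open U" "bounded_linear L" "smooth_fun A U f"
  shows "smooth_fun A U (\<lambda>q. L (f q))"
  unfolding smooth_fun_def
proof
  fix c assume c: "c \<in> A"
  show "smooth_on ((\<lambda>q. L (f q)) \<circ> chart_inv c) (snd c ` (fst c \<inter> U))"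
    using smooth_on_linear_compose[OF chart_image_open'[OF A c assms(1)], of L "f \<circ> chart_inv c"]
      assms(2,3) c unfolding smooth_fun_def by (simp add: comp_def)
qed

lemma smooth_fun_powr:
  fixes h :: "'m \<Rightarrow> real"
  assumes "open U" "smooth_fun A U h" "\<And>q. q \<in> U \<Longrightarrow> h q > 0"
  shows "smooth_fun A U (\<lambda>q. h q powr a)"
  unfolding smooth_fun_def
proof
  fix c assume c: "c \<in> A"
  have "smooth_on (\<lambda>z. (h \<circ> chart_inv c) z powr a) (snd c ` (fst c \<inter> U))"
    by (rule smooth_on_powr_compose[OF chart_image_open'[OF A c assms(1)]])
      (use assms c in \<open>auto simp: smooth_fun_def comp_def chart_inv_chart[OF A c]\<close>)
  then show "smooth_on ((\<lambda>q. h q powr a) \<circ> chart_inv c) (snd c ` (fst c \<inter> U))"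
    by (simp add: comp_def)
qed

lemma smooth_fun_snd: "c \<in> A \<Longrightarrow> smooth_fun A (fst c) (snd c)"
  unfolding smooth_fun_def using transition_smooth[OF A] by blast

text \<open>In the chart \<open>c\<close> the function is the derivative of \<open>f\<close> applied
  to the component vector of \<open>X\<close>. The target of \<open>f\<close> is any normed space,
  so \<open>f\<close> may also be the coordinate map of another chart; this is how components are
  compared between charts.\<close>

lemma smooth_fun_vderiv_chart:
  assumes "open U" "c \<in> A" "U \<subseteq> fst c" "smooth_fun A U f"
    "smooth_fun A U (\<lambda>q. vderiv A (snd c) q (X q))"
  shows "smooth_fun A U (\<lambda>q. vderiv A f q (X q))"
proof (rule smooth_fun_chartI[OF assms(2,1,3)])
  note o = chart_image_open[OF A assms(2,1,3)]
  note s = smooth_on_derivative_apply[OF o smooth_fun_chartD[OF assms(4,2,3)]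
      smooth_fun_chartD[OF assms(5,2,3)]]
  show "smooth_on ((\<lambda>q. vderiv A f q (X q)) \<circ> chart_inv c) (snd c ` U)"
  proof (rule smooth_on_cong[OF o _ s])
    fix z assume "z \<in> snd c ` U"
    then obtain q where q: "q \<in> U" "z = snd c q" by auto
    then show "frechet_derivative (f \<circ> chart_inv c) (at z)
        (((\<lambda>q. vderiv A (snd c) q (X q)) \<circ> chart_inv c) z) = ((\<lambda>q. vderiv A f q (X q)) \<circ> chart_inv c) z"
      using vderiv_chart[OF assms(2) _ smooth_fun_mfd_differentiable[OF assms(4)], of q] assms(3)
        chart_inv_chart[OF A assms(2)] by auto
  qed
qed

section \<open>Smooth vector fields\<close>

lemma smooth_fieldD:
  "smooth_field A U X \<Longrightarrow> c \<in> A \<Longrightarrow> smooth_fun A (U \<inter> fst c) (\<lambda>q. vderiv A (snd c) q (X q))"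
  unfolding smooth_field_def by blast

lemma smooth_fun_vderiv:
  assumes "open U" "smooth_fun A U f" "smooth_field A U X"
  shows "smooth_fun A U (\<lambda>q. vderiv A f q (X q))"
proof (rule smooth_fun_local[OF assms(1)])
  fix p assume "p \<in> U"
  note c = chart_at[OF A, of p]
  have o: "open (U \<inter> fst (chart_at A p))" using assms(1) chart_open(1)[OF A c(1)] by (rule open_Int)
  have "smooth_fun A (U \<inter> fst (chart_at A p)) (\<lambda>q. vderiv A f q (X q))"
    by (rule smooth_fun_vderiv_chart[OF o c(1) _ smooth_fun_subset[OF assms(2)]
          smooth_fieldD[OF assms(3) c(1)]]) auto
  then show "\<exists>V. open V \<and> p \<in> V \<and> smooth_fun A (U \<inter> V) (\<lambda>q. vderiv A f q (X q))"
    using c chart_open(1)[OF A] by blast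
qed

text \<open>The components in another chart \<open>c'\<close> are the derivative of the map
  \<open>snd c'\<close> along \<open>X\<close>, so smoothness of the components in \<open>c\<close>
  carries over.\<close>

lemma smooth_field_chartI:
  assumes "open U" "c \<in> A" "U \<subseteq> fst c" "smooth_fun A U (\<lambda>q. vderiv A (snd c) q (X q))"
  shows "smooth_field A U X"
  unfolding smooth_field_def
proof
  fix c' assume c': "c' \<in> A"
  show "smooth_fun A (U \<inter> fst c') (\<lambda>q. vderiv A (snd c') q (X q))"
    by (rule smooth_fun_vderiv_chart[OF open_Int[OF assms(1) chart_open(1)[OF A c']] assms(2) _
          smooth_fun_subset[OF smooth_fun_snd[OF c']] smooth_fun_subset[OF assms(4)]])
      (use assms(3) in auto)
qed

lemma smooth_field_subset: "smooth_field A U X \<Longrightarrow> V \<subseteq> U \<Longrightarrow> smooth_field A V X"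
  unfolding smooth_field_def by (meson Int_mono order_refl smooth_fun_subset)

lemma smooth_field_cong:
  assumes "open U" "\<And>q. q \<in> U \<Longrightarrow> X q = Y q" "smooth_field A U X"
  shows "smooth_field A U Y"
  unfolding smooth_field_def
proof
  fix c assume c: "c \<in> A"
  show "smooth_fun A (U \<inter> fst c) (\<lambda>p. vderiv A (snd c) p (Y p))"
    by (rule smooth_fun_cong[OF _ _ smooth_fieldD[OF assms(3) c]])
      (use assms chart_open(1)[OF A c] in auto)
qed

lemma smooth_field_coord: "c \<in> A \<Longrightarrow> smooth_field A (fst c) (coord_field A c w)"
  by (rule smooth_field_chartI[OF chart_open(1)[OF A] _ order_refl])
    (auto intro: smooth_fun_cong[OF chart_open(1)[OF A], of _ "\<lambda>q. w"] simp: coord_field)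

lemma vderiv_chart_linear:
  assumes "c \<in> A" "p \<in> fst c"
  shows "vderiv A (snd c) p (v + w) = vderiv A (snd c) p v + vderiv A (snd c) p w"
    "vderiv A (snd c) p (a *\<^sub>R v) = a *\<^sub>R vderiv A (snd c) p v"
    "vderiv A (snd c) p 0 = 0"
  using linear_vderiv[OF mfd_differentiable_snd[OF assms]]
  by (auto simp: linear_add linear_scale linear_0)

lemma smooth_field_add:
  assumes "open U" "smooth_field A U X" "smooth_field A U Y"
  shows "smooth_field A U (\<lambda>q. X q + Y q)"
  unfolding smooth_field_def
proof
  fix c assume c: "c \<in> A"
  have o: "open (U \<inter> fst c)" using assms(1) chart_open(1)[OF A c] by blast
  show "smooth_fun A (U \<inter> fst c) (\<lambda>p. vderiv A (snd c) p (X p + Y p))"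
    by (rule smooth_fun_cong[OF o _ smooth_fun_add[OF o smooth_fieldD[OF assms(2) c]
            smooth_fieldD[OF assms(3) c]]]) (simp add: vderiv_chart_linear[OF c])
qed

lemma smooth_field_scaleR:
  assumes "open U" "smooth_fun A U h" "smooth_field A U X"
  shows "smooth_field A U (\<lambda>q. h q *\<^sub>R X q)"
  unfolding smooth_field_def
proof
  fix c assume c: "c \<in> A"
  have o: "open (U \<inter> fst c)" using assms(1) chart_open(1)[OF A c] by blast
  show "smooth_fun A (U \<inter> fst c) (\<lambda>p. vderiv A (snd c) p (h p *\<^sub>R X p))"
    by (rule smooth_fun_cong[OF o _ smooth_fun_scaleR[OF o smooth_fun_subset[OF assms(2)]
            smooth_fieldD[OF assms(3) c]]]) (auto simp add: vderiv_chart_linear[OF c])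
qed

lemma smooth_field_zero [simp]: "smooth_field A U (\<lambda>q. 0)"
  unfolding smooth_field_def
proof
  fix c assume c: "c \<in> A"
  have "smooth_fun A (fst c) (\<lambda>p. vderiv A (snd c) p 0)"
    by (rule smooth_fun_cong[OF chart_open(1)[OF A c] _ smooth_fun_const[of _ 0]])
      (simp add: vderiv_chart_linear[OF c])
  then show "smooth_fun A (U \<inter> fst c) (\<lambda>p. vderiv A (snd c) p 0)"
    by (rule smooth_fun_subset) blast
qed

lemma smooth_field_sum:
  assumes "open U" "finite I" "\<And>i. i \<in> I \<Longrightarrow> smooth_field A U (X i)"
  shows "smooth_field A U (\<lambda>q. \<Sum>i\<in>I. X i q)"
  using assms(2,3) by induction (auto intro: smooth_field_add[OF assms(1)])

end

section \<open>Smooth maps and product manifolds\<close>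

lemma smooth_on_Pair:
  assumes "open S" "smooth_on f S" "smooth_on g S"
  shows "smooth_on (\<lambda>x. (f x, g x)) S"
proof -
  have 1: "bounded_linear (\<lambda>a. (a, 0))" "bounded_linear (\<lambda>a. (0, a))"
    by (intro bounded_linear_Pair bounded_linear_ident bounded_linear_zero)+
  show ?thesis
    using smooth_on_add[OF assms(1) smooth_on_linear_compose[OF assms(1) 1(1) assms(2)]
        smooth_on_linear_compose[OF assms(1) 1(2) assms(3)]] by simp
qed

lemma smooth_fun_Pair:
  assumes A: "smooth_atlas A" and "open U" "smooth_fun A U f" "smooth_fun A U g"
  shows "smooth_fun A U (\<lambda>x. (f x, g x))"
  unfolding smooth_fun_def
proof
  fix c assume c: "c \<in> A"
  show "smooth_on ((\<lambda>q. (f q, g q)) \<circ> chart_inv c) (snd c ` (fst c \<inter> U))"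
    using smooth_on_Pair[OF chart_image_open'[OF A c assms(2)], of "f \<circ> chart_inv c" "g \<circ> chart_inv c"]
      assms(3,4) c unfolding smooth_fun_def by (simp add: comp_def)
qed

lemma vderiv_Pair:
  assumes "mfd_differentiable A f p" "mfd_differentiable A g p"
  shows "mfd_differentiable A (\<lambda>q. (f q, g q)) p"
    "vderiv A (\<lambda>q. (f q, g q)) p v = (vderiv A f p v, vderiv A g p v)"
proof -
  have "(((\<lambda>q. (f q, g q)) \<circ> chart_inv (chart_at A p)) has_derivative
      (\<lambda>v. (vderiv A f p v, vderiv A g p v))) (at (snd (chart_at A p) p))"
    using has_derivative_Pair[OF assms[unfolded vderiv_has_derivative]]
    by (simp add: comp_def)
  from vderivI[OF this] show "mfd_differentiable A (\<lambda>q. (f q, g q)) p"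
    "vderiv A (\<lambda>q. (f q, g q)) p v = (vderiv A f p v, vderiv A g p v)" by auto
qed

context
  fixes A :: "('m::{t2_space,second_countable_topology}, 'e::euclidean_space) atlas"
    and A' :: "('n::{t2_space,second_countable_topology}, 'k::euclidean_space) atlas"
    and h :: "'m \<Rightarrow> 'n"
  assumes A: "smooth_atlas A" and A': "smooth_atlas A'" and h: "smooth_map A A' h"
begin

lemma smooth_map_continuous: "continuous_on UNIV h"
  using h unfolding smooth_map_def by blast

lemma smooth_map_vimage_open: "open W \<Longrightarrow> open (h -` W)"
  using smooth_map_continuous by (simp add: open_vimage)

lemma smooth_map_chart: "c' \<in> A' \<Longrightarrow> smooth_fun A (h -` fst c') (\<lambda>q. snd c' (h q))"
  using h unfolding smooth_map_def comp_def by blast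

lemma mdiff_has_derivative:
  "(((\<lambda>q. snd (chart_at A' (h p)) (h q)) \<circ> chart_inv (chart_at A p)) has_derivative mdiff A A' h p)
    (at (snd (chart_at A p) p))"
  using smooth_fun_mfd_differentiable[OF A smooth_map_chart[OF chart_at(1)[OF A', of "h p"]], of p]
    chart_at(2)[OF A', of "h p"]
  unfolding vderiv_has_derivative mdiff_def by (simp add: comp_def)

lemma linear_mdiff: "linear (mdiff A A' h p)"
  using has_derivative_linear[OF mdiff_has_derivative] .

lemma vderiv_compose:
  assumes "mfd_differentiable A' f (h p)"
  shows "mfd_differentiable A (\<lambda>q. f (h q)) p"
    "vderiv A (\<lambda>q. f (h q)) p v = vderiv A' f (h p) (mdiff A A' h p v)"
proof -
  let ?c = "chart_at A p" and ?c' = "chart_at A' (h p)"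
  note c = chart_at[OF A, of p] and c' = chart_at[OF A', of "h p"]
  let ?k = "(\<lambda>q. snd ?c' (h q)) \<circ> chart_inv ?c"
  have "?k (snd ?c p) = snd ?c' (h p)" by (simp add: chart_inv_chart[OF A c])
  then have "((\<lambda>z. (f \<circ> chart_inv ?c') (?k z)) has_derivative
      (\<lambda>v. vderiv A' f (h p) (mdiff A A' h p v))) (at (snd ?c p))"
    using has_derivative_compose[OF mdiff_has_derivative[of p], where g = "f \<circ> chart_inv ?c'"]
      assms unfolding vderiv_has_derivative by metis
  then have "(((\<lambda>q. f (h q)) \<circ> chart_inv ?c) has_derivative
      (\<lambda>v. vderiv A' f (h p) (mdiff A A' h p v))) (at (snd ?c p))"
    by (rule has_derivative_transform_within_open[OF _
          chart_image_open'[OF A c(1) smooth_map_vimage_open[OF chart_open(1)[OF A' c'(1)]]]])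
      (use c c' in \<open>auto simp: chart_inv_chart[OF A c(1)] chart_inv_chart[OF A' c'(1)]\<close>)
  from vderivI[OF this] show "mfd_differentiable A (\<lambda>q. f (h q)) p"
    "vderiv A (\<lambda>q. f (h q)) p v = vderiv A' f (h p) (mdiff A A' h p v)" by auto
qed

lemma smooth_fun_compose:
  assumes "open W" "smooth_fun A' W f"
  shows "smooth_fun A (h -` W) (\<lambda>q. f (h q))"
proof (rule smooth_fun_local[OF A smooth_map_vimage_open[OF assms(1)]])
  fix p assume p: "p \<in> h -` W"
  let ?c' = "chart_at A' (h p)"
  note c' = chart_at[OF A', of "h p"]
  let ?V = "h -` fst ?c'"
  note oc = chart_open(1)[OF A' c'(1)]
  have oW: "open (W \<inter> fst ?c')" using assms(1) oc by (rule open_Int)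
  have "smooth_fun A (h -` W \<inter> ?V) (\<lambda>q. f (h q))"
    unfolding smooth_fun_def
  proof
    fix c assume c: "c \<in> A"
    let ?S = "snd c ` (fst c \<inter> (h -` W \<inter> ?V))"
    have "open (h -` W \<inter> ?V)" using smooth_map_vimage_open assms(1) oc by blast
    then have S: "open ?S" by (rule chart_image_open'[OF A c])
    have "smooth_fun A (h -` W \<inter> ?V) (\<lambda>q. snd ?c' (h q))"
      using smooth_fun_subset[OF A smooth_map_chart[OF c'(1)]] by blast
    then have 1: "smooth_on ((\<lambda>q. snd ?c' (h q)) \<circ> chart_inv c) ?S"
      using c unfolding smooth_fun_def by blast
    have 2: "smooth_on (f \<circ> chart_inv ?c') (snd ?c' ` (W \<inter> fst ?c'))"
      by (rule smooth_fun_chartD[OF A' smooth_fun_subset[OF A' assms(2)] c'(1)]) auto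
    have "smooth_on (\<lambda>z. (f \<circ> chart_inv ?c') (((\<lambda>q. snd ?c' (h q)) \<circ> chart_inv c) z)) ?S"
      by (rule smooth_on_compose[OF S chart_image_open[OF A' c'(1) oW] _ 2 1])
        (auto simp: chart_inv_chart[OF A c])
    then show "smooth_on ((\<lambda>q. f (h q)) \<circ> chart_inv c) ?S"
      by (rule smooth_on_cong[OF S, rotated])
        (auto simp: chart_inv_chart[OF A c] chart_inv_chart[OF A' c'(1)])
  qed
  then show "\<exists>V. open V \<and> p \<in> V \<and> smooth_fun A (h -` W \<inter> V) (\<lambda>q. f (h q))"
    using smooth_map_vimage_open[OF oc] c'(2) by blast
qed

end

section \<open>Product manifolds and their projections\<close>

abbreviation prod_chart :: "('m, 'e) chart \<Rightarrow> ('n, 'k) chart \<Rightarrow> ('m \<times> 'n, 'e \<times> 'k) chart" where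
  "prod_chart c c' \<equiv> (fst c \<times> fst c', map_prod (snd c) (snd c'))"

context
  fixes A :: "('m::{t2_space,second_countable_topology}, 'e::euclidean_space) atlas"
    and A' :: "('n::{t2_space,second_countable_topology}, 'k::euclidean_space) atlas"
  assumes A: "smooth_atlas A" and A': "smooth_atlas A'"
begin

lemma chart_inv_prod:
  assumes "c \<in> A" "c' \<in> A'" "q \<in> fst c" "q' \<in> fst c'"
  shows "chart_inv (prod_chart c c') (snd c q, snd c' q') = (q, q')"
proof -
  have "inj_on (snd c) (fst c)" "inj_on (snd c') (fst c')"
    using chart_inv_chart[OF A assms(1)] chart_inv_chart[OF A' assms(2)] by (metis inj_on_inverseI)+
  then have "inj_on (map_prod (snd c) (snd c')) (fst c \<times> fst c')"
    by (rule map_prod_inj_on)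
  then show ?thesis
    using inv_into_f_f[of "map_prod (snd c) (snd c')" "fst c \<times> fst c'" "(q, q')"] assms(3,4)
    unfolding chart_inv_def by simp
qed

lemma smooth_on_chart_fst:
  fixes f :: "'m \<Rightarrow> 'v::real_normed_vector"
  assumes "c \<in> A" "c' \<in> A'" "open U" "smooth_fun A U f"
  shows "smooth_on ((\<lambda>q. f (fst q)) \<circ> chart_inv (prod_chart c c'))
    (snd (prod_chart c c') ` (fst (prod_chart c c') \<inter> fst -` U))"
proof -
  have eq: "snd (prod_chart c c') ` (fst (prod_chart c c') \<inter> fst -` U)
      = (snd c ` (fst c \<inter> U)) \<times> (snd c' ` fst c')" by force
  have o: "open ((snd c ` (fst c \<inter> U)) \<times> (snd c' ` fst c'))"
    by (intro open_Times chart_image_open'[OF A assms(1,3)] chart_open(2)[OF A' assms(2)])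
  have "smooth_on (\<lambda>z. (f \<circ> chart_inv c) (fst z)) ((snd c ` (fst c \<inter> U)) \<times> (snd c' ` fst c'))"
    by (rule smooth_on_compose[OF o chart_image_open'[OF A assms(1,3)] _ _
          smooth_on_linear[OF bounded_linear_fst]])
      (use assms(1,4) in \<open>auto simp: smooth_fun_def comp_def\<close>)
  then show ?thesis
    unfolding eq
    by (rule smooth_on_cong[OF o, rotated])
      (auto simp: chart_inv_prod[OF assms(1,2)] chart_inv_chart[OF A assms(1)])
qed

lemma smooth_on_chart_snd:
  fixes f :: "'n \<Rightarrow> 'v::real_normed_vector"
  assumes "c \<in> A" "c' \<in> A'" "open U" "smooth_fun A' U f"
  shows "smooth_on ((\<lambda>q. f (snd q)) \<circ> chart_inv (prod_chart c c'))
    (snd (prod_chart c c') ` (fst (prod_chart c c') \<inter> snd -` U))"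
proof -
  have eq: "snd (prod_chart c c') ` (fst (prod_chart c c') \<inter> snd -` U)
      = (snd c ` fst c) \<times> (snd c' ` (fst c' \<inter> U))" by force
  have o: "open ((snd c ` fst c) \<times> (snd c' ` (fst c' \<inter> U)))"
    by (intro open_Times chart_image_open'[OF A' assms(2,3)] chart_open(2)[OF A assms(1)])
  have "smooth_on (\<lambda>z. (f \<circ> chart_inv c') (snd z)) ((snd c ` fst c) \<times> (snd c' ` (fst c' \<inter> U)))"
    by (rule smooth_on_compose[OF o chart_image_open'[OF A' assms(2,3)] _ _
          smooth_on_linear[OF bounded_linear_snd]])
      (use assms(2,4) in \<open>auto simp: smooth_fun_def comp_def\<close>)
  then show ?thesis
    unfolding eq
    by (rule smooth_on_cong[OF o, rotated])
      (auto simp: chart_inv_prod[OF assms(1,2)] chart_inv_chart[OF A' assms(2)])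
qed

lemma smooth_atlas_product: "smooth_atlas (product_atlas A A')"
  unfolding smooth_atlas_def
proof (intro conjI ballI)
  have "q \<in> \<Union>(fst ` product_atlas A A')" for q
  proof -
    have "prod_chart (chart_at A (fst q)) (chart_at A' (snd q)) \<in> product_atlas A A'"
      unfolding product_atlas_def using chart_at(1)[OF A] chart_at(1)[OF A'] by blast
    moreover have "q \<in> fst (prod_chart (chart_at A (fst q)) (chart_at A' (snd q)))"
      using chart_at(2)[OF A, of "fst q"] chart_at(2)[OF A', of "snd q"] by (simp add: mem_Times_iff)
    ultimately show ?thesis by blast
  qed
  then show "\<Union>(fst ` product_atlas A A') = UNIV" by blast
next
  fix d assume "d \<in> product_atlas A A'"
  then obtain c c' where d: "d = prod_chart c c'" and c: "c \<in> A" and c': "c' \<in> A'"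
    unfolding product_atlas_def by blast
  have im: "snd d ` fst d = (snd c ` fst c) \<times> (snd c' ` fst c')" unfolding d by force
  show "open (fst d)" using chart_open(1)[OF A c] chart_open(1)[OF A' c'] by (simp add: d open_Times)
  show "open (snd d ` fst d)"
    unfolding im by (intro open_Times chart_open(2)[OF A c] chart_open(2)[OF A' c'])
  have inv: "chart_inv d z = (chart_inv c (fst z), chart_inv c' (snd z))" if "z \<in> snd d ` fst d" for z
    using that chart_inv_prod[OF c c'] chart_inv_chart[OF A c] chart_inv_chart[OF A' c']
    unfolding d by auto
  have conts: "continuous_on (snd c ` fst c) (chart_inv c)" "continuous_on (snd c' ` fst c') (chart_inv c')"
    "continuous_on (fst c) (snd c)" "continuous_on (fst c') (snd c')"
    using chart_homeomorphism[OF A c] chart_homeomorphism[OF A' c'] unfolding homeomorphism_def by blast+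
  show "homeomorphism (fst d) (snd d ` fst d) (snd d) (chart_inv d)"
  proof (rule homeomorphismI)
    have "continuous_on (fst c \<times> fst c') (\<lambda>q. (snd c (fst q), snd c' (snd q)))"
      by (intro continuous_on_Pair continuous_on_compose2[OF conts(3)] continuous_on_compose2[OF conts(4)]
          continuous_on_fst continuous_on_snd continuous_on_id) auto
    then show "continuous_on (fst d) (snd d)"
      by (simp add: d map_prod_def case_prod_beta)
    have "continuous_on (snd d ` fst d) (\<lambda>z. (chart_inv c (fst z), chart_inv c' (snd z)))"
      unfolding im
      by (intro continuous_on_Pair continuous_on_compose2[OF conts(1)] continuous_on_compose2[OF conts(2)]
          continuous_on_fst continuous_on_snd continuous_on_id) auto
    then show "continuous_on (snd d ` fst d) (chart_inv d)"
      by (rule continuous_on_eq) (simp add: inv)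
  qed (use chart_inv_prod[OF c c'] in \<open>auto simp: d\<close>)
next
  fix d d' assume "d \<in> product_atlas A A'" "d' \<in> product_atlas A A'"
  then obtain c c' e e' where d: "d = prod_chart c c'" and c: "c \<in> A" and c': "c' \<in> A'"
    and d': "d' = prod_chart e e'" and e: "e \<in> A" and e': "e' \<in> A'"
    unfolding product_atlas_def by blast
  let ?S = "snd d ` (fst d \<inter> fst d')"
  have eq: "?S = (snd c ` (fst c \<inter> fst e)) \<times> (snd c' ` (fst c' \<inter> fst e'))"
    unfolding d d' by force
  have o: "open ?S"
    unfolding eq by (intro open_Times chart_image_open'[OF A c chart_open(1)[OF A e]]
        chart_image_open'[OF A' c' chart_open(1)[OF A' e']])
  have "smooth_on (\<lambda>z. ((\<lambda>q. snd e (fst q)) \<circ> chart_inv d) z) ?S"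
    using smooth_on_chart_fst[OF c c' chart_open(1)[OF A e] smooth_fun_snd[OF A e]]
    unfolding d d' by (rule smooth_on_subset) auto
  moreover have "smooth_on (\<lambda>z. ((\<lambda>q. snd e' (snd q)) \<circ> chart_inv d) z) ?S"
    using smooth_on_chart_snd[OF c c' chart_open(1)[OF A' e'] smooth_fun_snd[OF A' e']]
    unfolding d d' by (rule smooth_on_subset) auto
  ultimately have "smooth_on (\<lambda>z. (((\<lambda>q. snd e (fst q)) \<circ> chart_inv d) z,
      ((\<lambda>q. snd e' (snd q)) \<circ> chart_inv d) z)) ?S"
    by (rule smooth_on_Pair[OF o])
  then show "smooth_on (snd d' \<circ> chart_inv d) ?S"
    by (rule smooth_on_cong[OF o, rotated]) (simp add: d' map_prod_def case_prod_beta)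
qed

lemma smooth_map_fst: "smooth_map (product_atlas A A') A fst"
  unfolding smooth_map_def smooth_fun_def
proof (intro conjI ballI)
  fix e d assume e: "e \<in> A" and "d \<in> product_atlas A A'"
  then obtain c c' where d: "d = prod_chart c c'" and c: "c \<in> A" and c': "c' \<in> A'"
    unfolding product_atlas_def by blast
  show "smooth_on (snd e \<circ> fst \<circ> chart_inv d) (snd d ` (fst d \<inter> fst -` fst e))"
    using smooth_on_chart_fst[OF c c' chart_open(1)[OF A e] smooth_fun_snd[OF A e]]
    unfolding d by (simp add: comp_def)
qed (simp add: continuous_on_fst)

lemma smooth_map_snd: "smooth_map (product_atlas A A') A' snd"
  unfolding smooth_map_def smooth_fun_def
proof (intro conjI ballI)
  fix e d assume e: "e \<in> A'" and "d \<in> product_atlas A A'"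
  then obtain c c' where d: "d = prod_chart c c'" and c: "c \<in> A" and c': "c' \<in> A'"
    unfolding product_atlas_def by blast
  show "smooth_on (snd e \<circ> snd \<circ> chart_inv d) (snd d ` (fst d \<inter> snd -` fst e))"
    using smooth_on_chart_snd[OF c c' chart_open(1)[OF A' e] smooth_fun_snd[OF A' e]]
    unfolding d by (simp add: comp_def)
qed (simp add: continuous_on_snd)

end

section \<open>Affine connections and totally geodesic immersions\<close>

context
  fixes A :: "('m::{t2_space,second_countable_topology}, 'e::euclidean_space) atlas"
    and nabla :: "('m \<Rightarrow> 'e) \<Rightarrow> ('m \<Rightarrow> 'e) \<Rightarrow> 'm \<Rightarrow> 'e"
  assumes A: "smooth_atlas A" and conn: "affine_connection A nabla"
begin

lemma affine_connection_rules:
  assumes "open U" "smooth_field A U X" "smooth_field A U Y" "smooth_field A U Z"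
    "smooth_fun A U (h :: 'm \<Rightarrow> real)"
  shows "smooth_field A U (nabla X Y)"
    "\<And>p. p \<in> U \<Longrightarrow> nabla (\<lambda>q. X q + Y q) Z p = nabla X Z p + nabla Y Z p"
    "\<And>p. p \<in> U \<Longrightarrow> nabla (\<lambda>q. h q *\<^sub>R X q) Y p = h p *\<^sub>R nabla X Y p"
    "\<And>p. p \<in> U \<Longrightarrow> nabla X (\<lambda>q. Y q + Z q) p = nabla X Y p + nabla X Z p"
    "\<And>p. p \<in> U \<Longrightarrow>
      nabla X (\<lambda>q. h q *\<^sub>R Y q) p = vderiv A h p (X p) *\<^sub>R Y p + h p *\<^sub>R nabla X Y p"
proof -
  have "smooth_field A U (nabla X Y) \<and>
        (\<forall>p\<in>U. nabla (\<lambda>q. X q + Y q) Z p = nabla X Z p + nabla Y Z p \<and>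
               nabla (\<lambda>q. h q *\<^sub>R X q) Y p = h p *\<^sub>R nabla X Y p \<and>
               nabla X (\<lambda>q. Y q + Z q) p = nabla X Y p + nabla X Z p \<and>
               nabla X (\<lambda>q. h q *\<^sub>R Y q) p = vderiv A h p (X p) *\<^sub>R Y p + h p *\<^sub>R nabla X Y p)"
    using conn[unfolded affine_connection_def, rule_format, of U X Y Z h] assms by simp
  then show "smooth_field A U (nabla X Y)"
    "\<And>p. p \<in> U \<Longrightarrow> nabla (\<lambda>q. X q + Y q) Z p = nabla X Z p + nabla Y Z p"
    "\<And>p. p \<in> U \<Longrightarrow> nabla (\<lambda>q. h q *\<^sub>R X q) Y p = h p *\<^sub>R nabla X Y p"
    "\<And>p. p \<in> U \<Longrightarrow> nabla X (\<lambda>q. Y q + Z q) p = nabla X Y p + nabla X Z p"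
    "\<And>p. p \<in> U \<Longrightarrow>
      nabla X (\<lambda>q. h q *\<^sub>R Y q) p = vderiv A h p (X p) *\<^sub>R Y p + h p *\<^sub>R nabla X Y p"
    by simp_all
qed

lemma smooth_field_nabla:
  "open U \<Longrightarrow> smooth_field A U X \<Longrightarrow> smooth_field A U Y \<Longrightarrow> smooth_field A U (nabla X Y)"
  by (rule affine_connection_rules(1)[OF _ _ _ smooth_field_zero[OF A] smooth_fun_const[OF A]])

lemma nabla_scaleR_left:
  assumes "open U" "smooth_field A U X" "smooth_field A U Y" "smooth_fun A U h" "p \<in> U"
  shows "nabla (\<lambda>q. h q *\<^sub>R X q) Y p = h p *\<^sub>R nabla X Y p"
  by (rule affine_connection_rules(3)[OF assms(1-3) smooth_field_zero[OF A] assms(4,5)])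

lemma nabla_scaleR_right:
  assumes "open U" "smooth_field A U X" "smooth_field A U Y" "smooth_fun A U h" "p \<in> U"
  shows "nabla X (\<lambda>q. h q *\<^sub>R Y q) p = vderiv A h p (X p) *\<^sub>R Y p + h p *\<^sub>R nabla X Y p"
  by (rule affine_connection_rules(5)[OF assms(1-3) smooth_field_zero[OF A] assms(4,5)])

lemma nabla_add_left:
  assumes "open U" "smooth_field A U X" "smooth_field A U Y" "smooth_field A U Z" "p \<in> U"
  shows "nabla (\<lambda>q. X q + Y q) Z p = nabla X Z p + nabla Y Z p"
  by (rule affine_connection_rules(2)[OF assms(1-4) smooth_fun_const[OF A] assms(5)])

lemma nabla_add_right:
  assumes "open U" "smooth_field A U X" "smooth_field A U Y" "smooth_field A U Z" "p \<in> U"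
  shows "nabla X (\<lambda>q. Y q + Z q) p = nabla X Y p + nabla X Z p"
  by (rule affine_connection_rules(4)[OF assms(1-4) smooth_fun_const[OF A] assms(5)])

text \<open>A field that vanishes on \<open>U\<close> equals its product with the function that is 0 on \<open>U\<close> and 1
  elsewhere; hence \<open>nabla\<close> is local in both arguments.\<close>

lemma nabla_zero:
  assumes "open U" "p \<in> U" "\<And>q. q \<in> U \<Longrightarrow> Z q = 0" "smooth_field A U Y"
  shows "nabla Z Y p = 0" "nabla Y Z p = 0"
proof -
  define h :: "'m \<Rightarrow> real" where "h q = (if q \<in> U then 0 else 1)" for q
  have h: "smooth_fun A U h"
    by (rule smooth_fun_cong[OF A assms(1) _ smooth_fun_const[OF A, of U 0]]) (simp add: h_def)
  have Z: "smooth_field A U Z"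
    by (rule smooth_field_cong[OF A assms(1) _ smooth_field_zero[OF A]]) (simp add: assms(3))
  have eq: "Z = (\<lambda>q. h q *\<^sub>R Z q)" using assms(3) by (auto simp: h_def)
  have "nabla (\<lambda>q. h q *\<^sub>R Z q) Y p = h p *\<^sub>R nabla Z Y p"
    by (rule nabla_scaleR_left[OF assms(1) Z assms(4) h assms(2)])
  then show "nabla Z Y p = 0" using eq assms(2) by (simp add: h_def)
  have "nabla Y (\<lambda>q. h q *\<^sub>R Z q) p = vderiv A h p (Y p) *\<^sub>R Z p + h p *\<^sub>R nabla Y Z p"
    by (rule nabla_scaleR_right[OF assms(1,4) Z h assms(2)])
  then show "nabla Y Z p = 0" using eq assms(2,3) by (simp add: h_def)
qed

lemma nabla_cong:
  assumes "open U" "p \<in> U" "\<And>q. q \<in> U \<Longrightarrow> X q = X' q" "smooth_field A U X" "smooth_field A U Y"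
  shows "nabla X Y p = nabla X' Y p" "nabla Y X p = nabla Y X' p"
proof -
  define Z where "Z q = X' q - X q" for q
  have Z0: "Z q = 0" if "q \<in> U" for q using assms(3)[OF that] by (simp add: Z_def)
  have Z: "smooth_field A U Z"
    by (rule smooth_field_cong[OF A assms(1) _ smooth_field_zero[OF A]]) (simp add: Z0)
  \<comment> \<open>This is an equality of total functions, so it may be substituted inside
    \<open>nabla\<close>; only the difference \<open>Z\<close> needs the locality argument.\<close>
  have eq: "X' = (\<lambda>q. X q + Z q)" by (simp add: Z_def)
  show "nabla X Y p = nabla X' Y p"
    unfolding eq nabla_add_left[OF assms(1,4) Z assms(5,2)]
    using nabla_zero(1)[OF assms(1,2) Z0 assms(5)] by simp
  show "nabla Y X p = nabla Y X' p"
    unfolding eq nabla_add_right[OF assms(1,5,4) Z assms(2)]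
    using nabla_zero(2)[OF assms(1,2) Z0 assms(5)] by simp
qed

lemma nabla_sum:
  assumes "open U" "p \<in> U" "finite I" "\<And>i. i \<in> I \<Longrightarrow> smooth_field A U (X i)" "smooth_field A U Y"
  shows "nabla (\<lambda>q. \<Sum>i\<in>I. X i q) Y p = (\<Sum>i\<in>I. nabla (X i) Y p)"
    "nabla Y (\<lambda>q. \<Sum>i\<in>I. X i q) p = (\<Sum>i\<in>I. nabla Y (X i) p)"
  using assms(3,4)
proof (induction I)
  case empty
  {
    case 1 show ?case using nabla_zero(1)[OF assms(1,2) _ assms(5)] by simp
  next
    case 2 show ?case using nabla_zero(2)[OF assms(1,2) _ assms(5)] by simp
  }
next
  case (insert i I)
  have s: "smooth_field A U (X i)" "smooth_field A U (\<lambda>q. \<Sum>i\<in>I. X i q)" if "\<And>j. j \<in> insert i I \<Longrightarrow> smooth_field A U (X j)"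
    using that insert.hyps by (auto intro: smooth_field_sum[OF A assms(1)])
  {
    case 1
    show ?case
      using insert nabla_add_left[OF assms(1) s assms(5,2)] 1 by simp
  next
    case 2
    show ?case
      using insert nabla_add_right[OF assms(1,5) s assms(2)] 2 by simp
  }
qed

section \<open>Coordinate expressions of a connection\<close>

lemma coord_representation:
  assumes "c \<in> A" "q \<in> fst c"
  shows "(\<Sum>b\<in>Basis. (vderiv A (snd c) q v \<bullet> b) *\<^sub>R coord_field A c b q) = v"
proof -
  let ?w = "vderiv A (snd c) q v"
  have "v = coord_field A c (\<Sum>b\<in>Basis. (?w \<bullet> b) *\<^sub>R b) q"
    by (simp add: euclidean_representation coord_field[OF A assms])
  also have "\<dots> = (\<Sum>b\<in>Basis. (?w \<bullet> b) *\<^sub>R coord_field A c b q)"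
    using linear_sum[OF linear_coord_field[OF A assms], of "\<lambda>b. (?w \<bullet> b) *\<^sub>R b" Basis]
      linear_scale[OF linear_coord_field[OF A assms]] by simp
  finally show ?thesis by simp
qed

lemma smooth_component:
  assumes "open U" "c \<in> A" "smooth_field A U X"
  shows "smooth_fun A (U \<inter> fst c) (\<lambda>q. vderiv A (snd c) q (X q) \<bullet> b)"
  by (rule smooth_fun_linear_compose[OF A open_Int[OF assms(1) chart_open(1)[OF A assms(2)]]
        bounded_linear_inner_left smooth_fieldD[OF A assms(3,2)]])

text \<open>Expanding \<open>X\<close> in the coordinate frame and pulling out the coefficient
  functions shows that only the value of \<open>X\<close> at \<open>p\<close> matters. This permits
  replacing the direction field by one with constant components.\<close>

lemma nabla_tensorial:
  assumes "open U" "smooth_field A U X" "smooth_field A U Y" "p \<in> U" "c \<in> A" "p \<in> fst c"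
  shows "nabla X Y p = (\<Sum>b\<in>Basis. (vderiv A (snd c) p (X p) \<bullet> b) *\<^sub>R nabla (coord_field A c b) Y p)"
proof -
  let ?V = "U \<inter> fst c"
  have o: "open ?V" using assms(1) chart_open(1)[OF A assms(5)] by (rule open_Int)
  have p: "p \<in> ?V" using assms by blast
  have E: "smooth_field A ?V (coord_field A c b)" for b
    by (rule smooth_field_subset[OF A smooth_field_coord[OF A assms(5)]]) blast
  have X: "smooth_field A ?V X" and Y: "smooth_field A ?V Y"
    using smooth_field_subset[OF A assms(2)] smooth_field_subset[OF A assms(3)] by blast+
  have "nabla X Y p
      = nabla (\<lambda>q. \<Sum>b\<in>Basis. (vderiv A (snd c) q (X q) \<bullet> b) *\<^sub>R coord_field A c b q) Y p"
    by (rule nabla_cong(1)[OF o p _ X Y]) (simp add: coord_representation[OF assms(5)])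
  also have "\<dots> = (\<Sum>b\<in>Basis. nabla (\<lambda>q. (vderiv A (snd c) q (X q) \<bullet> b) *\<^sub>R coord_field A c b q) Y p)"
    by (rule nabla_sum(1)[OF o p finite_Basis
          smooth_field_scaleR[OF A o smooth_component[OF assms(1,5,2)] E] Y])
  also have "\<dots> = (\<Sum>b\<in>Basis. (vderiv A (snd c) p (X p) \<bullet> b) *\<^sub>R nabla (coord_field A c b) Y p)"
    by (intro sum.cong refl nabla_scaleR_left[OF o E Y smooth_component[OF assms(1,5,2)] p])
  finally show ?thesis .
qed

lemma nabla_eq_at:
  assumes "open U" "smooth_field A U X" "smooth_field A U X'" "smooth_field A U Y" "p \<in> U" "X p = X' p"
  shows "nabla X Y p = nabla X' Y p"
  unfolding nabla_tensorial[OF assms(1,2,4,5) chart_at[OF A]]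
    nabla_tensorial[OF assms(1,3,4,5) chart_at[OF A]] assms(6) ..

text \<open>The Leibniz rule applied to the expansion of \<open>Y\<close> in the coordinate frame.
  The result has the shape of \<open>covderiv_along\<close>, which is what allows a comparison with
  derivatives along an immersion.\<close>

lemma nabla_coordinates:
  assumes "open U" "smooth_field A U X" "smooth_field A U Y" "p \<in> U"
  defines "c \<equiv> chart_at A p"
  shows "nabla X Y p = vderiv A (\<lambda>q. vderiv A (snd c) q (Y q)) p (X p)
    + (\<Sum>b\<in>Basis. (Y p \<bullet> b) *\<^sub>R nabla X (coord_field A c b) p)"
proof -
  have c: "c \<in> A" "p \<in> fst c" unfolding c_def by (rule chart_at[OF A])+
  let ?V = "U \<inter> fst c"
  let ?Y = "\<lambda>q. vderiv A (snd c) q (Y q)"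
  have o: "open ?V" using assms(1) chart_open(1)[OF A c(1)] by (rule open_Int)
  have p: "p \<in> ?V" using assms c by blast
  have E: "smooth_field A ?V (coord_field A c b)" for b
    by (rule smooth_field_subset[OF A smooth_field_coord[OF A c(1)]]) blast
  have X: "smooth_field A ?V X" and Y: "smooth_field A ?V Y"
    using smooth_field_subset[OF A assms(2)] smooth_field_subset[OF A assms(3)] by blast+
  note sc = smooth_component[OF assms(1) c(1) assms(3)]
  have d: "mfd_differentiable A ?Y p"
    by (rule smooth_fun_mfd_differentiable[OF A smooth_fieldD[OF A assms(3) c(1)] p])
  have "nabla X Y p = nabla X (\<lambda>q. \<Sum>b\<in>Basis. (?Y q \<bullet> b) *\<^sub>R coord_field A c b q) p"
    by (rule nabla_cong(2)[OF o p _ Y X]) (simp add: coord_representation[OF c(1)])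
  also have "\<dots> = (\<Sum>b\<in>Basis. nabla X (\<lambda>q. (?Y q \<bullet> b) *\<^sub>R coord_field A c b q) p)"
    by (rule nabla_sum(2)[OF o p finite_Basis smooth_field_scaleR[OF A o sc E] X])
  also have "\<dots> = (\<Sum>b\<in>Basis. vderiv A (\<lambda>q. ?Y q \<bullet> b) p (X p) *\<^sub>R coord_field A c b p
      + (?Y p \<bullet> b) *\<^sub>R nabla X (coord_field A c b) p)"
    by (intro sum.cong refl nabla_scaleR_right[OF o X E sc p])
  \<comment> \<open>At \<open>p\<close> the coordinate frame of the fixed chart is the standard
    basis itself, so the first summands reassemble to the derivative of the component
    vector.\<close>
  also have "\<dots> = (\<Sum>b\<in>Basis. (vderiv A ?Y p (X p) \<bullet> b) *\<^sub>R b
      + (Y p \<bullet> b) *\<^sub>R nabla X (coord_field A c b) p)"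
    unfolding vderiv_linear_compose(2)[OF A bounded_linear_inner_left d]
    by (simp add: c_def coord_field_chart_at[OF A] vderiv_chart_at[OF A])
  finally show ?thesis by (simp add: sum.distrib euclidean_representation)
qed

end

text \<open>For a field \<open>Y'\<close> that restricts along \<open>psi\<close> to the image of
  \<open>Y\<close>, the derivative along \<open>psi\<close> of that image is
  \<open>nabla' X' Y'\<close>. The Gauss formula with vanishing second fundamental form then
  identifies it with the image of \<open>nabla X Y\<close>.\<close>

lemma totally_geodesic_related:
  fixes A :: "('m::{t2_space,second_countable_topology}, 'e::euclidean_space) atlas"
    and A' :: "('n::{t2_space,second_countable_topology}, 'k::euclidean_space) atlas"
  assumes A: "smooth_atlas A" and A': "smooth_atlas A'" and psi: "smooth_map A A' psi"
    and conn: "affine_connection A' nabla'" and tg: "totally_geodesic A nabla A' nabla' psi"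
    and U: "open U" "p \<in> U" and W: "open W" "psi ` U \<subseteq> W"
    and XY: "smooth_field A U X" "smooth_field A U Y" "smooth_field A' W X'" "smooth_field A' W Y'"
    and rel: "\<And>q. q \<in> U \<Longrightarrow> X' (psi q) = mdiff A A' psi q (X q)"
      "\<And>q. q \<in> U \<Longrightarrow> Y' (psi q) = mdiff A A' psi q (Y q)"
  shows "nabla' X' Y' (psi p) = mdiff A A' psi p (nabla X Y p)"
proof -
  define c where "c = chart_at A' (psi p)"
  have c: "c \<in> A'" "psi p \<in> fst c" unfolding c_def by (rule chart_at[OF A'])+
  have pW: "psi p \<in> W" using U W by blast
  let ?Y = "\<lambda>y. vderiv A' (snd c) y (Y' y)"
  let ?x = "mdiff A A' psi p (X p)"
  have Yd: "mfd_differentiable A' ?Y (psi p)"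
    by (rule smooth_fun_mfd_differentiable[OF A' smooth_fieldD[OF A' XY(4) c(1)]]) (use pW c in blast)
  have "vderiv A (\<lambda>q. vderiv A' (snd c) (psi q) (mdiff A A' psi q (Y q))) p = vderiv A (\<lambda>q. ?Y (psi q)) p"
    by (rule vderiv_cong(2)[OF A U _ vderiv_compose(1)[OF A A' psi Yd], symmetric]) (simp add: rel)
  then have 1: "vderiv A (\<lambda>q. vderiv A' (snd c) (psi q) (mdiff A A' psi q (Y q))) p (X p)
      = vderiv A' ?Y (psi p) ?x"
    using vderiv_compose(2)[OF A A' psi Yd] by simp
  have o: "open (W \<inter> fst c)" using W(1) chart_open(1)[OF A' c(1)] by (rule open_Int)
  have E: "smooth_field A' (W \<inter> fst c) (coord_field A' c w)" for w
    by (rule smooth_field_subset[OF A' smooth_field_coord[OF A' c(1)]]) blast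
  have X': "smooth_field A' (W \<inter> fst c) X'" by (rule smooth_field_subset[OF A' XY(3)]) blast
  \<comment> \<open>\<open>covderiv_along\<close> differentiates in the direction of a field with
    constant components; it agrees with \<open>X'\<close> at \<open>psi p\<close>, and that is
    enough by tensoriality.\<close>
  have 2: "nabla' (coord_field A' c ?x) (coord_field A' c b) (psi p) = nabla' X' (coord_field A' c b) (psi p)"
    for b
    by (rule nabla_eq_at[OF A' conn o E X' E])
      (use pW c rel(1)[OF U(2)] coord_field_chart_at[OF A'] in \<open>auto simp: c_def\<close>)
  have "nabla' X' Y' (psi p) = vderiv A' ?Y (psi p) (X' (psi p))
      + (\<Sum>b\<in>Basis. (Y' (psi p) \<bullet> b) *\<^sub>R nabla' X' (coord_field A' c b) (psi p))"
    unfolding c_def by (rule nabla_coordinates[OF A' conn W(1) XY(3,4) pW])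
  also have "\<dots> = covderiv_along A A' nabla' psi X (\<lambda>q. mdiff A A' psi q (Y q)) p"
    unfolding covderiv_along_def Let_def c_def[symmetric] 1 2 using rel[OF U(2)] by simp
  also have "\<dots> = mdiff A A' psi p (nabla X Y p)"
    using tg U XY unfolding totally_geodesic_def second_fundamental_form_def
    by (metis eq_iff_diff_eq_0)
  finally show ?thesis .
qed

text \<open>A local left inverse \<open>r\<close> of \<open>psi\<close> extends the components of
  the image of \<open>X\<close> to a neighbourhood by composition with \<open>r\<close>. The sets
  \<open>U\<close> and \<open>W\<close> are chosen before \<open>X\<close>, so that several fields
  can be extended to one common domain.\<close>

lemma immersion_extend_fields:
  fixes A :: "('m::{t2_space,second_countable_topology}, 'e::euclidean_space) atlas"
    and A' :: "('n::{t2_space,second_countable_topology}, 'k::euclidean_space) atlas"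
  assumes A: "smooth_atlas A" and A': "smooth_atlas A'" and psi: "smooth_map A A' psi"
    and inj: "inj (mdiff A A' psi p)" and dim: "DIM('e) = 2" and N: "open N" "p \<in> N"
  obtains U W where "open U" "p \<in> U" "U \<subseteq> N" "open W" "psi ` U \<subseteq> W"
    "\<And>X. smooth_field A U X \<Longrightarrow>
      \<exists>X'. smooth_field A' W X' \<and> (\<forall>q\<in>U. X' (psi q) = mdiff A A' psi q (X q))"
proof -
  define c where "c = chart_at A p"
  define c' where "c' = chart_at A' (psi p)"
  have c: "c \<in> A" "p \<in> fst c" unfolding c_def by (rule chart_at[OF A])+
  have c': "c' \<in> A'" "psi p \<in> fst c'" unfolding c'_def by (rule chart_at[OF A'])+
  define k where "k q = snd c' (psi q)" for q
  define V0 where "V0 = psi -` fst c' \<inter> N"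
  have V0: "open V0" "p \<in> V0"
    using smooth_map_vimage_open[OF A A' psi chart_open(1)[OF A' c'(1)]] N c' by (auto simp: V0_def)
  have k: "smooth_fun A V0 k"
    using smooth_fun_subset[OF A smooth_map_chart[OF A A' psi c'(1)]] unfolding k_def V0_def by blast
  define Q where "Q = snd c ` (fst c \<inter> V0)"
  have Q: "open Q" "snd c p \<in> Q"
    using chart_image_open'[OF A c(1) V0(1)] c V0 by (auto simp: Q_def)
  have phi: "smooth_on (k \<circ> chart_inv c) Q"
    using k c unfolding smooth_fun_def Q_def by blast
  have Dphi: "((k \<circ> chart_inv c) has_derivative mdiff A A' psi p) (at (snd c p))"
    using mdiff_has_derivative[OF A A' psi, of p] unfolding k_def c_def c'_def .
  \<comment> \<open>Composing \<open>psi\<close> in coordinates with a linear left inverse of its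
    differential gives a map \<open>G\<close> between spaces of equal dimension whose derivative at
    the point is the identity.\<close>
  obtain P where P: "linear P" "P \<circ> mdiff A A' psi p = id"
    using linear_injective_left_inverse[OF linear_mdiff[OF A A' psi] inj] by blast
  have blP: "bounded_linear P" using P(1) by (simp add: linear_conv_bounded_linear)
  define G where "G z = P ((k \<circ> chart_inv c) z)" for z
  have G: "smooth_on G Q" unfolding G_def by (rule smooth_on_linear_compose[OF Q(1) blP phi])
  have "(G has_derivative (\<lambda>v. P (mdiff A A' psi p v))) (at (snd c p))"
    unfolding G_def by (rule bounded_linear.has_derivative[OF blP Dphi])
  moreover have "(\<lambda>v. P (mdiff A A' psi p v)) = id" using P(2) by (simp add: comp_def)
  ultimately have "frechet_derivative G (at (snd c p)) = id"
    using frechet_derivative_at by metis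
  then have bij: "bij (frechet_derivative G (at (snd c p)))" by simp
  obtain U0 V h where U0: "open U0" "U0 \<subseteq> Q" "snd c p \<in> U0" and V: "open V"
    and hom: "homeomorphism U0 V G h" and h: "smooth_on h V"
    using smooth_inverse_function[OF dim Q(1) G Q(2) bij] by blast
  \<comment> \<open>\<open>U\<close> is the chart domain over which \<open>G\<close> is inverted by
    \<open>h\<close>, and \<open>W\<close> is the set where \<open>h\<close> may be applied after
    \<open>P\<close>.\<close>
  define U where "U = fst c \<inter> snd c -` U0"
  define W where "W = fst c' \<inter> snd c' -` (P -` V)"
  have U: "open U" "p \<in> U" "U \<subseteq> fst c"
    using chart_vimage_open[OF A c(1) U0(1)] c(2) U0(3) by (auto simp: U_def)
  have imU: "snd c ` U = U0"
    using U0(2) unfolding U_def Q_def by blast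
  have "open (P -` V)" using V blP by (simp add: open_vimage linear_continuous_on)
  then have W: "open W" unfolding W_def by (rule chart_vimage_open[OF A' c'(1)])
  have UV0: "U \<subseteq> V0"
  proof
    fix q assume q: "q \<in> U"
    then have "snd c q \<in> snd c ` (fst c \<inter> V0)" using U0(2) by (auto simp: U_def Q_def)
    then obtain q' where q': "q' \<in> fst c" "q' \<in> V0" "snd c q = snd c q'" by blast
    have "q = chart_inv c (snd c q)" using chart_inv_chart[OF A c(1), of q] U(3) q by auto
    also have "\<dots> = q'" using chart_inv_chart[OF A c(1) q'(1)] q'(3) by simp
    finally show "q \<in> V0" using q'(2) by simp
  qed
  have Gk: "G (snd c q) = P (k q)" if "q \<in> U" for q
    using chart_inv_chart[OF A c(1), of q] subsetD[OF U(3) that] by (simp add: G_def)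
  have rho: "P (k q) \<in> V" "h (P (k q)) = snd c q" if "q \<in> U" for q
  proof -
    have q: "snd c q \<in> U0" using that by (simp add: U_def)
    show "P (k q) \<in> V" "h (P (k q)) = snd c q"
      unfolding Gk[OF that, symmetric]
      using homeomorphism_image1[OF hom] homeomorphism_apply1[OF hom q] q by auto
  qed
  have psiU: "psi ` U \<subseteq> W"
    using UV0 rho(1) by (auto simp: W_def V0_def k_def)
  have kU: "smooth_fun A U k" by (rule smooth_fun_subset[OF A k UV0])
  show ?thesis
  proof (rule that[OF U(1,2) _ W psiU])
    show "U \<subseteq> N" using UV0 by (auto simp: V0_def)
    fix X assume X: "smooth_field A U X"
    define H where "H q = vderiv A k q (X q)" for q
    \<comment> \<open>Left inverse of \<open>psi\<close> on \<open>U\<close>: project the ambient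
      coordinates by \<open>P\<close>, undo \<open>G\<close>, return to the surface.\<close>
    define r where "r y = chart_inv c (h (P (snd c' y)))" for y
    define X' where "X' y = coord_field A' c' (H (r y)) y" for y
    have H: "smooth_fun A U H" unfolding H_def by (rule smooth_fun_vderiv[OF A U(1) kU X])
    have Hc: "smooth_on (H \<circ> chart_inv c) U0"
      using smooth_fun_chartD[OF A H c(1) U(3)] unfolding imU .
    have Wc: "W \<subseteq> fst c'" by (auto simp: W_def)
    have oW: "open (snd c' ` W)" by (rule chart_image_open[OF A' c'(1) W Wc])
    have hV: "h ` V \<subseteq> U0" using hom by (auto simp: homeomorphism_def)
    have PW: "P ` snd c' ` W \<subseteq> V" by (auto simp: W_def)
    have "smooth_on (\<lambda>z. h (P z)) (snd c' ` W)"
      by (rule smooth_on_compose[OF oW V PW h smooth_on_linear[OF blP]])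
    then have "smooth_on (\<lambda>z. (H \<circ> chart_inv c) (h (P z))) (snd c' ` W)"
      by (rule smooth_on_compose[OF oW U0(1) _ Hc, rotated]) (use hV PW in blast)
    then have "smooth_on ((\<lambda>y. H (r y)) \<circ> chart_inv c') (snd c' ` W)"
      by (rule smooth_on_cong[OF oW, rotated])
        (use Wc in \<open>auto simp: r_def chart_inv_chart[OF A' c'(1)]\<close>)
    then have "smooth_fun A' W (\<lambda>y. H (r y))"
      by (rule smooth_fun_chartI[OF A' c'(1) W Wc])
    then have "smooth_fun A' W (\<lambda>y. vderiv A' (snd c') y (X' y))"
      by (rule smooth_fun_cong[OF A' W, rotated])
        (use Wc in \<open>auto simp: X'_def coord_field[OF A' c'(1)]\<close>)
    then have "smooth_field A' W X'"
      by (rule smooth_field_chartI[OF A' W c'(1) Wc])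
    moreover have "X' (psi q) = mdiff A A' psi q (X q)" if q: "q \<in> U" for q
    proof -
      have pq: "psi q \<in> fst c'" using psiU q by (auto simp: W_def)
      have "r (psi q) = q"
        using rho(2)[OF q] q U(3) chart_inv_chart[OF A c(1)] by (auto simp: r_def k_def)
      moreover have "H q = vderiv A' (snd c') (psi q) (mdiff A A' psi q (X q))"
        unfolding H_def k_def
        by (rule vderiv_compose(2)[OF A A' psi mfd_differentiable_snd[OF A' c'(1) pq]])
      ultimately show ?thesis by (simp add: X'_def coord_field[OF A' c'(1) pq])
    qed
    ultimately show "\<exists>X'. smooth_field A' W X' \<and> (\<forall>q\<in>U. X' (psi q) = mdiff A A' psi q (X q))"
      by blast
  qed
qed

section \<open>Curvature of a warped product of curves\<close>

definition inner_form :: "('e::euclidean_space \<Rightarrow> 'e \<Rightarrow> real) \<Rightarrow> bool" where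
  "inner_form G \<longleftrightarrow> bilinear G \<and> (\<forall>u v. G u v = G v u) \<and> (\<forall>v. v \<noteq> 0 \<longrightarrow> G v v > 0)"

lemma riemannian_metric_inner_form: "riemannian_metric A g \<Longrightarrow> inner_form (g p)"
  unfolding riemannian_metric_def inner_form_def by blast

lemma inner_form_simps:
  assumes "inner_form G"
  shows "G (u + v) w = G u w + G v w" "G w (u + v) = G w u + G w v"
    "G (a *\<^sub>R u) w = a * G u w" "G w (a *\<^sub>R u) = a * G w u"
    "G (u - v) w = G u w - G v w" "G 0 w = 0" "G w 0 = 0"
  using assms[unfolded inner_form_def, THEN conjunct1]
  by (simp_all add: bilinear_ladd bilinear_radd bilinear_lmul bilinear_rmul bilinear_lsub
      bilinear_lzero bilinear_rzero)

lemma inner_form_sym: "inner_form G \<Longrightarrow> G u v = G v u"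
  unfolding inner_form_def by blast

lemma inner_form_zero: "inner_form G \<Longrightarrow> G v v = 0 \<Longrightarrow> v = 0"
  unfolding inner_form_def by (metis less_irrefl)

text \<open>Pairwise orthogonal nonzero vectors are independent, and \<open>DIM('e)\<close> of them
  span. So \<open>v\<close> is a combination of vectors orthogonal to it and has length
  zero.\<close>

lemma inner_form_orthogonal_zero:
  fixes G :: "'e::euclidean_space \<Rightarrow> 'e \<Rightarrow> real"
  assumes G: "inner_form G" and "finite S" "card S = DIM('e)" "0 \<notin> S"
    and orth: "\<And>s t. s \<in> S \<Longrightarrow> t \<in> S \<Longrightarrow> s \<noteq> t \<Longrightarrow> G s t = 0"
    and v: "\<And>s. s \<in> S \<Longrightarrow> G v s = 0"
  shows "v = 0"
proof -
  have Gsum: "G x (\<Sum>s\<in>S. u s *\<^sub>R s) = (\<Sum>s\<in>S. u s * G x s)" for x u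
  proof -
    have "linear (G x)" using G unfolding inner_form_def bilinear_def by blast
    then show ?thesis by (simp add: linear_sum linear_scale)
  qed
  have "independent S"
    unfolding independent_explicit_finite_subsets
  proof (intro allI impI ballI)
    fix R u s assume R: "R \<subseteq> S" "finite R" "(\<Sum>w\<in>R. u w *\<^sub>R w) = 0" and s: "s \<in> R"
    have "linear (G s)" using G unfolding inner_form_def bilinear_def by blast
    then have "(\<Sum>w\<in>R. u w * G s w) = G s (\<Sum>w\<in>R. u w *\<^sub>R w)"
      by (simp add: linear_sum linear_scale)
    also have "\<dots> = 0" using R(3) inner_form_simps(7)[OF G] by simp
    finally have "(\<Sum>w\<in>R. u w * G s w) = 0" .
    moreover have "(\<Sum>w\<in>R. u w * G s w) = (\<Sum>w\<in>R. if w = s then u s * G s s else 0)"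
      using R(1) s orth by (intro sum.cong) auto
    ultimately have "u s * G s s = 0" using R(2) s by simp
    moreover have "s \<noteq> 0" using s R(1) assms(4) by blast
    ultimately show "u s = 0" using inner_form_zero[OF G] by auto
  qed
  then have "span S = UNIV"
    using card_ge_dim_independent[of S UNIV] assms(3) by auto
  then have "v \<in> range (\<lambda>u. \<Sum>s\<in>S. u s *\<^sub>R s)"
    using span_finite[OF assms(2)] by simp
  then obtain u where "v = (\<Sum>s\<in>S. u s *\<^sub>R s)" by blast
  then have "G v v = 0" using Gsum[of v u] v by simp
  then show ?thesis by (rule inner_form_zero[OF G])
qed

lemma inner_form_zero_dim1:
  fixes G :: "'e::euclidean_space \<Rightarrow> 'e \<Rightarrow> real"
  assumes "inner_form G" "DIM('e) = 1" "e \<noteq> 0" "G v e = 0"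
  shows "v = 0"
  by (rule inner_form_orthogonal_zero[OF assms(1), of "{e}"]) (use assms in auto)

text \<open>Writing the inner products as multiples of \<open>G e e\<close> and \<open>G t t\<close>
  avoids division: the frame it serves is orthogonal, but its second member has length
  \<open>r\<close>.\<close>

lemma inner_form_expand_dim2:
  fixes G :: "'e::euclidean_space \<Rightarrow> 'e \<Rightarrow> real"
  assumes G: "inner_form G" and "DIM('e) = 2" "G e e > 0" "G t t > 0" "G e t = 0"
    and v: "G v e = a * G e e" "G v t = b * G t t"
  shows "v = a *\<^sub>R e + b *\<^sub>R t"
proof -
  have te: "G t e = 0" using inner_form_sym[OF G] assms(5) by metis
  have ne: "e \<noteq> t" using assms(3,5) by force
  have nz: "0 \<notin> {e, t}" using assms(3,4) inner_form_simps(6)[OF G, of 0] by force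
  have v0: "G (v - (a *\<^sub>R e + b *\<^sub>R t)) e = 0" "G (v - (a *\<^sub>R e + b *\<^sub>R t)) t = 0"
    by (simp_all add: inner_form_simps[OF G] v te assms(5))
  have "v - (a *\<^sub>R e + b *\<^sub>R t) = 0"
    by (rule inner_form_orthogonal_zero[OF G _ _ nz])
      (use assms(2,5) te ne v0 in auto)
  then show ?thesis by simp
qed

section \<open>Levi-Civita connections and their curvature\<close>

lemma levi_civita_connection: "levi_civita A g nabla \<Longrightarrow> affine_connection A nabla"
  unfolding levi_civita_def by blast

lemma levi_civita_torsion_free:
  assumes "levi_civita A g nabla" "open U" "smooth_field A U X" "smooth_field A U Y" "p \<in> U"
  shows "lie_bracket A X Y p = nabla X Y p - nabla Y X p"
  using assms(1)[unfolded levi_civita_def, THEN conjunct2, rule_format, of U X Y Y p] assms by simp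

lemma levi_civita_metric:
  assumes "levi_civita A g nabla" "open U" "smooth_field A U X" "smooth_field A U Y"
    "smooth_field A U Z" "p \<in> U"
  shows "vderiv A (\<lambda>q. g q (Y q) (Z q)) p (X p) = g p (nabla X Y p) (Z p) + g p (Y p) (nabla X Z p)"
  using assms(1)[unfolded levi_civita_def, THEN conjunct2, rule_format, of U X Y Z p] assms by simp

text \<open>Curvature is built from covariant derivatives and a bracket, and all of these preserve
  relatedness along a totally geodesic map.\<close>

lemma curvature_related:
  fixes A :: "('m::{t2_space,second_countable_topology}, 'e::euclidean_space) atlas"
    and A' :: "('n::{t2_space,second_countable_topology}, 'k::euclidean_space) atlas"
  assumes A: "smooth_atlas A" and A': "smooth_atlas A'" and psi: "smooth_map A A' psi"
    and lc: "levi_civita A g nabla" and lc': "levi_civita A' g' nabla'"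
    and tg: "totally_geodesic A nabla A' nabla' psi"
    and U: "open U" "p \<in> U" and W: "open W" "psi ` U \<subseteq> W"
    and sm: "smooth_field A U X" "smooth_field A U Y" "smooth_field A U Z"
      "smooth_field A' W X'" "smooth_field A' W Y'" "smooth_field A' W Z'"
    and rel: "\<And>q. q \<in> U \<Longrightarrow> X' (psi q) = mdiff A A' psi q (X q)"
      "\<And>q. q \<in> U \<Longrightarrow> Y' (psi q) = mdiff A A' psi q (Y q)"
      "\<And>q. q \<in> U \<Longrightarrow> Z' (psi q) = mdiff A A' psi q (Z q)"
  shows "curvature A' nabla' X' Y' Z' (psi p) = mdiff A A' psi p (curvature A nabla X Y Z p)"
proof -
  note conn = levi_civita_connection[OF lc] and conn' = levi_civita_connection[OF lc']
  note R = totally_geodesic_related[OF A A' psi conn' tg U(1) _ W]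
  note s = smooth_field_nabla[OF A conn U(1)] and s' = smooth_field_nabla[OF A' conn' W(1)]
  have br: "smooth_field A U (lie_bracket A X Y)"
  proof (rule smooth_field_cong[OF A U(1)])
    show "smooth_field A U (\<lambda>q. nabla X Y q + (-1) *\<^sub>R nabla Y X q)"
      by (rule smooth_field_add[OF A U(1) s[OF sm(1,2)]
            smooth_field_scaleR[OF A U(1) smooth_fun_const[OF A] s[OF sm(2,1)]]])
  qed (simp add: levi_civita_torsion_free[OF lc U(1) sm(1,2)])
  have br': "smooth_field A' W (lie_bracket A' X' Y')"
  proof (rule smooth_field_cong[OF A' W(1)])
    show "smooth_field A' W (\<lambda>q. nabla' X' Y' q + (-1) *\<^sub>R nabla' Y' X' q)"
      by (rule smooth_field_add[OF A' W(1) s'[OF sm(4,5)]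
            smooth_field_scaleR[OF A' W(1) smooth_fun_const[OF A'] s'[OF sm(5,4)]]])
  qed (simp add: levi_civita_torsion_free[OF lc' W(1) sm(4,5)])
  have lin: "mdiff A A' psi q (u - v) = mdiff A A' psi q u - mdiff A A' psi q v" for q u v
    by (rule linear_diff[OF linear_mdiff[OF A A' psi]])
  \<comment> \<open>Vanishing torsion turns both brackets into differences of covariant derivatives,
    which are already known to be related.\<close>
  have brel: "lie_bracket A' X' Y' (psi q) = mdiff A A' psi q (lie_bracket A X Y q)" if q: "q \<in> U" for q
  proof -
    have "psi q \<in> W" using q W by blast
    then show ?thesis
      unfolding levi_civita_torsion_free[OF lc U(1) sm(1,2) q] lin
        levi_civita_torsion_free[OF lc' W(1) sm(4,5) \<open>psi q \<in> W\<close>]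
      using R[OF q sm(1,2,4,5) rel(1,2)] R[OF q sm(2,1,5,4) rel(2,1)] by simp
  qed
  \<comment> \<open>The second derivatives require the inner derivatives to be related on all of
    \<open>U\<close>, not only at \<open>p\<close>; the nested uses of \<open>R\<close> supply
    this.\<close>
  show ?thesis
    unfolding curvature_def lin
    using R[OF U(2) sm(1) s[OF sm(2,3)] sm(4) s'[OF sm(5,6)] rel(1) R[OF _ sm(2,3,5,6) rel(2,3)]]
      R[OF U(2) sm(2) s[OF sm(1,3)] sm(5) s'[OF sm(4,6)] rel(2) R[OF _ sm(1,3,4,6) rel(1,3)]]
      R[OF U(2) br sm(3) br' sm(6) brel rel(3)]
    by simp
qed

text \<open>With \<open>k = E r / r\<close> the unit field \<open>Z = h T\<close> is parallel along
  \<open>E\<close>, and the curvature is minus the Riccati expression \<open>E k + k^2\<close>,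
  which equals \<open>E (E r) / r\<close>. Only \<open>h^2 r^2 = 1\<close> is assumed, so both signs
  of \<open>h\<close> are covered.\<close>

lemma warped_frame_curvature:
  fixes A :: "('m::{t2_space,second_countable_topology}, 'e::euclidean_space) atlas"
    and h r :: "'m \<Rightarrow> real"
  assumes A: "smooth_atlas A" and lc: "levi_civita A g nabla" and g: "\<And>q. inner_form (g q)"
    and dim: "DIM('e) = 2" and U: "open U"
    and E: "smooth_field A U E" and T: "smooth_field A U T" and r: "smooth_fun A U r"
    and h: "smooth_fun A U h" and rpos: "\<And>q. q \<in> U \<Longrightarrow> r q > 0"
    and EE: "\<And>q. q \<in> U \<Longrightarrow> g q (E q) (E q) = 1" and ET: "\<And>q. q \<in> U \<Longrightarrow> g q (E q) (T q) = 0"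
    and TT: "\<And>q. q \<in> U \<Longrightarrow> g q (T q) (T q) = (r q)\<^sup>2"
    and rT: "\<And>q. q \<in> U \<Longrightarrow> vderiv A r q (T q) = 0"
    and br: "\<And>q. q \<in> U \<Longrightarrow> lie_bracket A E T q = 0"
    and hr: "\<And>q. q \<in> U \<Longrightarrow> (h q)\<^sup>2 * (r q)\<^sup>2 = 1"
    and p: "p \<in> U"
  shows "curvature A nabla E (\<lambda>q. h q *\<^sub>R T q) (\<lambda>q. h q *\<^sub>R T q) p
    = (- vderiv A (\<lambda>q. vderiv A r q (E q)) p (E p) / r p) *\<^sub>R E p"
proof -
  note conn = levi_civita_connection[OF lc]
  define r1 where "r1 q = vderiv A r q (E q)" for q
  \<comment> \<open>The logarithmic derivative of \<open>r\<close> along \<open>E\<close>; the power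
    form gives its smoothness.\<close>
  define k where "k q = r1 q * r q powr (-1)" for q
  define Z where "Z = (\<lambda>q. h q *\<^sub>R T q)"
  have r1: "smooth_fun A U r1" unfolding r1_def by (rule smooth_fun_vderiv[OF A U r E])
  have k: "smooth_fun A U k"
    unfolding k_def using smooth_fun_scaleR[OF A U r1 smooth_fun_powr[OF A U r rpos, of "-1"]] by simp
  have kr: "k q * r q = r1 q" if "q \<in> U" for q
    using rpos[OF that] by (simp add: k_def powr_minus)
  have Z: "smooth_field A U Z" unfolding Z_def by (rule smooth_field_scaleR[OF A U h T])
  have md: "mfd_differentiable A r q" "mfd_differentiable A h q" "mfd_differentiable A k q" if "q \<in> U" for q
    using smooth_fun_mfd_differentiable[OF A _ that] r h k by blast+
  have TE: "g q (T q) (E q) = 0" if "q \<in> U" for q using ET[OF that] inner_form_sym[OF g] by metis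
  have const: "vderiv A F q v = 0" if "q \<in> U" "\<And>x. x \<in> U \<Longrightarrow> F x = a" for F :: "'m \<Rightarrow> real" and a q v
    using vderiv_cong(2)[OF A U that(1), of "\<lambda>x. a" F] that(2) vderiv_const[OF A, of a q] by metis
  note met = levi_civita_metric[OF lc U]
  have expand: "v = a *\<^sub>R E q + b *\<^sub>R T q" if "q \<in> U" "g q v (E q) = a" "g q v (T q) = b * (r q)\<^sup>2" for q v a b
    by (rule inner_form_expand_dim2[OF g dim, of q])
      (use EE[OF that(1)] ET[OF that(1)] TT[OF that(1)] rpos[OF that(1)] that(2,3) in simp_all)
  have r2: "vderiv A (\<lambda>x. g x (T x) (T x)) q v = 2 * r q * vderiv A r q v" if q: "q \<in> U" for q v
  proof -
    have "vderiv A (\<lambda>x. r x * r x) q = vderiv A (\<lambda>x. g x (T x) (T x)) q"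
      by (rule vderiv_cong(2)[OF A U q])
        (use TT vderiv_scaleR(1)[OF A md(1) md(1)] q in \<open>auto simp: power2_eq_square\<close>)
    then show ?thesis using vderiv_mult[OF A md(1)[OF q] md(1)[OF q], of v] by simp
  qed
  have com: "nabla E T q = nabla T E q" if "q \<in> U" for q
    using levi_civita_torsion_free[OF lc U E T that] br[OF that] by simp
  \<comment> \<open>The inner products of the frame derivatives come from differentiating
    \<open>g(E,E) = 1\<close>, \<open>g(T,T) = r^2\<close> and \<open>g(E,T) = 0\<close>. The
    symmetry \<open>com\<close> carries information from \<open>nabla T E\<close> to
    \<open>nabla E T\<close> and back, which yields \<open>a5\<close> and \<open>a6\<close>.\<close>
  have a1: "g q (nabla E E q) (E q) = 0" if q: "q \<in> U" for q
    using met[OF E E E q] const[OF q EE] inner_form_sym[OF g, of q "E q"] by simp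
  have a2: "g q (nabla T E q) (E q) = 0" if q: "q \<in> U" for q
    using met[OF T E E q] const[OF q EE] inner_form_sym[OF g, of q "E q"] by simp
  have a3: "g q (nabla E T q) (T q) = r q * r1 q" if q: "q \<in> U" for q
    using met[OF E T T q] r2[OF q] inner_form_sym[OF g, of q "T q"] by (simp add: r1_def)
  have a4: "g q (nabla T T q) (T q) = 0" if q: "q \<in> U" for q
    using met[OF T T T q] r2[OF q] rT[OF q] inner_form_sym[OF g, of q "T q"] by simp
  have a5: "g q (nabla E E q) (T q) = 0" if q: "q \<in> U" for q
    using met[OF E E T q] const[OF q ET] a2[OF q] com[OF q] inner_form_sym[OF g, of q "E q"] by simp
  have a6: "g q (nabla T T q) (E q) = - (r q * r1 q)" if q: "q \<in> U" for q
    using met[OF T T E q] const[OF q TE] a3[OF q] com[OF q] inner_form_sym[OF g, of q "T q"] by simp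
  have EE0: "nabla E E q = 0" if q: "q \<in> U" for q
    using expand[OF q, of "nabla E E q" 0 0] a1[OF q] a5[OF q] by simp
  have ETk: "nabla E T q = k q *\<^sub>R T q" if q: "q \<in> U" for q
    using expand[OF q, of "nabla E T q" 0 "k q"] a2[OF q] a3[OF q] com[OF q] kr[OF q]
    by (simp add: power2_eq_square)
  have TT1: "nabla T T q = (- (r q * r1 q)) *\<^sub>R E q" if q: "q \<in> U" for q
    using expand[OF q, of "nabla T T q" _ 0] a4[OF q] a6[OF q] by simp
  \<comment> \<open>Differentiating \<open>(h r)^2 = 1\<close> and cancelling the nonzero factor
    \<open>h r\<close> shows that \<open>h r\<close> has zero derivative.\<close>
  have dh: "vderiv A h q v * r q + h q * vderiv A r q v = 0" if q: "q \<in> U" for q v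
  proof -
    let ?hr = "\<lambda>x. h x * r x"
    have d: "mfd_differentiable A ?hr q" using vderiv_scaleR(1)[OF A md(2) md(1)] q by simp
    have "vderiv A (\<lambda>x. ?hr x * ?hr x) q v = 0"
      by (rule const[OF q, of _ 1]) (use hr in \<open>simp add: power2_eq_square algebra_simps\<close>)
    then have "?hr q * vderiv A ?hr q v = 0" using vderiv_mult[OF A d d, of v] by simp
    moreover have "?hr q \<noteq> 0" using hr[OF q] by auto
    ultimately have "vderiv A ?hr q v = 0" by simp
    then show ?thesis using vderiv_mult[OF A md(2)[OF q] md(1)[OF q], of v] by simp
  qed
  have hE: "vderiv A h q (E q) + h q * k q = 0" if q: "q \<in> U" for q
  proof -
    have "(vderiv A h q (E q) + h q * k q) * r q = 0"
      using dh[OF q, of "E q"] kr[OF q] by (simp add: r1_def algebra_simps)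
    then show ?thesis using rpos[OF q] by simp
  qed
  have hT: "vderiv A h q (T q) = 0" if q: "q \<in> U" for q
    using dh[OF q, of "T q"] rT[OF q] rpos[OF q] by simp
  \<comment> \<open>The derivative of \<open>h\<close> along \<open>E\<close> is
    \<open>- h k\<close>, which cancels the term coming from \<open>nabla E T = k T\<close>.\<close>
  have EZ: "nabla E Z q = 0" if q: "q \<in> U" for q
    unfolding Z_def nabla_scaleR_right[OF A conn U E T h q] ETk[OF q]
    using hE[OF q] by (simp flip: scaleR_add_left)
  have ZE: "nabla Z E q = k q *\<^sub>R Z q" if q: "q \<in> U" for q
    unfolding Z_def nabla_scaleR_left[OF A conn U T E h q] com[OF q, symmetric] ETk[OF q] by simp
  have ZZ: "nabla Z Z q = (- k q) *\<^sub>R E q" if q: "q \<in> U" for q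
  proof -
    have "nabla Z Z q = h q *\<^sub>R nabla T Z q"
      using nabla_scaleR_left[OF A conn U T Z h q] unfolding Z_def[symmetric] .
    also have "nabla T Z q = h q *\<^sub>R nabla T T q"
      unfolding Z_def nabla_scaleR_right[OF A conn U T T h q] hT[OF q] by simp
    finally have "nabla Z Z q = (- ((h q)\<^sup>2 * (r q)\<^sup>2 * k q)) *\<^sub>R E q"
      unfolding TT1[OF q] kr[OF q, symmetric] by (simp add: power2_eq_square algebra_simps)
    then show ?thesis using hr[OF q] by simp
  qed
  have bEZ: "lie_bracket A E Z q = (- k q) *\<^sub>R Z q" if q: "q \<in> U" for q
    using levi_civita_torsion_free[OF lc U E Z q] EZ[OF q] ZE[OF q] by simp
  have mk: "smooth_fun A U (\<lambda>q. - k q)"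
    using smooth_fun_scaleR[OF A U smooth_fun_const[OF A, of U "-1"] k] by simp
  have dmk: "vderiv A (\<lambda>q. - k q) p v = - vderiv A k p v" for v
    using vderiv_mult[OF A vderiv_const(1)[OF A, of "-1"] md(3)[OF p], of v]
      vderiv_const(2)[OF A, of "-1::real" p v] by simp
  have sm: "smooth_field A U (\<lambda>q. (- k q) *\<^sub>R E q)" "smooth_field A U (\<lambda>q. (- k q) *\<^sub>R Z q)"
    by (rule smooth_field_scaleR[OF A U mk] E Z)+
  have 1: "nabla E (nabla Z Z) p = (- vderiv A k p (E p)) *\<^sub>R E p"
  proof -
    have "nabla E (nabla Z Z) p = nabla E (\<lambda>q. (- k q) *\<^sub>R E q) p"
      by (rule nabla_cong(2)[OF A conn U p _ sm(1) E, symmetric]) (simp add: ZZ)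
    then show ?thesis
      unfolding nabla_scaleR_right[OF A conn U E E mk p] dmk EE0[OF p] by simp
  qed
  have 2: "nabla Z (nabla E Z) p = 0"
    by (rule nabla_zero(2)[OF A conn U p EZ Z])
  \<comment> \<open>Rescaling \<open>T\<close> to unit length destroys commutation with
    \<open>E\<close>: the bracket becomes \<open>- k Z\<close> and contributes the quadratic
    term.\<close>
  have 3: "nabla (lie_bracket A E Z) Z p = (k p)\<^sup>2 *\<^sub>R E p"
  proof -
    have "nabla (lie_bracket A E Z) Z p = nabla (\<lambda>q. (- k q) *\<^sub>R Z q) Z p"
      by (rule nabla_cong(1)[OF A conn U p _ sm(2) Z, symmetric]) (simp add: bEZ)
    then show ?thesis
      unfolding nabla_scaleR_left[OF A conn U Z Z mk p] ZZ[OF p] by (simp add: power2_eq_square)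
  qed
  \<comment> \<open>The Riccati identity: differentiate \<open>k r = r1\<close> along
    \<open>E\<close> and divide by \<open>r\<close>.\<close>
  have 4: "vderiv A k p (E p) + (k p)\<^sup>2 = vderiv A r1 p (E p) / r p"
  proof -
    have "vderiv A (\<lambda>q. k q * r q) p = vderiv A r1 p"
      by (rule vderiv_cong(2)[OF A U p kr]) (use vderiv_scaleR(1)[OF A md(3) md(1)] p in auto)
    then have "vderiv A k p (E p) * r p + k p * r1 p = vderiv A r1 p (E p)"
      using vderiv_mult[OF A md(3)[OF p] md(1)[OF p], of "E p"] by (simp add: r1_def)
    then show ?thesis using rpos[OF p] kr[OF p] by (simp add: field_simps power2_eq_square)
  qed
  have "curvature A nabla E Z Z p = (- (vderiv A k p (E p) + (k p)\<^sup>2)) *\<^sub>R E p"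
    unfolding curvature_def 1 2 3 by (simp add: algebra_simps)
  then show ?thesis unfolding 4 Z_def r1_def by simp
qed

section \<open>Lifts to a product\<close>

context
  fixes A :: "('m::{t2_space,second_countable_topology}, 'e::euclidean_space) atlas"
    and A' :: "('n::{t2_space,second_countable_topology}, 'k::euclidean_space) atlas"
  assumes A: "smooth_atlas A" and A': "smooth_atlas A'"
begin

lemma vderiv_prod_chart:
  assumes "c \<in> A" "c' \<in> A'" "fst q \<in> fst c" "snd q \<in> fst c'"
  shows "vderiv (product_atlas A A') (snd (prod_chart c c')) q u
    = (vderiv A (snd c) (fst q) (mdiff (product_atlas A A') A fst q u),
       vderiv A' (snd c') (snd q) (mdiff (product_atlas A A') A' snd q u))"
proof -
  note P = smooth_atlas_product[OF A A']
  note 1 = vderiv_compose[OF P A smooth_map_fst[OF A A'] mfd_differentiable_snd[OF A assms(1,3)]]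
  note 2 = vderiv_compose[OF P A' smooth_map_snd[OF A A'] mfd_differentiable_snd[OF A' assms(2,4)]]
  have "snd (prod_chart c c') = (\<lambda>q. (snd c (fst q), snd c' (snd q)))" by auto
  then show ?thesis
    using vderiv_Pair(2)[OF 1(1) 2(1), of u] 1(2)[of u] 2(2)[of u] by simp
qed

text \<open>The fixed chart at \<open>q\<close> is some product chart, not necessarily the product
  of the fixed charts of the factors. The splitting of the tangent space is therefore given by the
  two differentials and not by the components of a pair. It is injective because the product of the
  fixed charts has a bijective differential that depends on these two images only.\<close>

lemma bij_mdiff_prod:
  "bij (\<lambda>u. (mdiff (product_atlas A A') A fst q u, mdiff (product_atlas A A') A' snd q u))"
proof -
  let ?P = "product_atlas A A'"
  note P = smooth_atlas_product[OF A A']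
  let ?c = "chart_at A (fst q)" and ?c' = "chart_at A' (snd q)"
  let ?L = "\<lambda>u. (mdiff ?P A fst q u, mdiff ?P A' snd q u)"
  have d: "prod_chart ?c ?c' \<in> ?P" "q \<in> fst (prod_chart ?c ?c')"
    unfolding product_atlas_def mem_Times_iff fst_conv
    using chart_at[OF A] chart_at[OF A'] by blast+
  have lin: "linear ?L"
    using linear_mdiff[OF P A smooth_map_fst[OF A A'], of q]
      linear_mdiff[OF P A' smooth_map_snd[OF A A'], of q]
    by (intro linearI) (simp_all add: linear_add linear_scale)
  have "inj ?L"
  proof (rule injI)
    fix u v assume "?L u = ?L v"
    then have "vderiv ?P (snd (prod_chart ?c ?c')) q u = vderiv ?P (snd (prod_chart ?c ?c')) q v"
      unfolding vderiv_prod_chart[OF chart_at(1)[OF A] chart_at(1)[OF A'] chart_at(2)[OF A] chart_at(2)[OF A']]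
      by simp
    then show "u = v" using bij_is_inj[OF bij_vderiv_chart[OF P d]] by (metis injD)
  qed
  then show ?thesis using lin by (simp add: bij_def linear_injective_imp_surjective)
qed

end

text \<open>The pair of factor vectors has to be transported through the inverse of the splitting,
  because tangent vectors of the product are expressed in a chart unrelated to the fixed charts of
  the factors.\<close>

definition prod_lift ::
    "('m, 'e::euclidean_space) atlas \<Rightarrow> ('n, 'k::euclidean_space) atlas
      \<Rightarrow> ('m \<Rightarrow> 'e) \<Rightarrow> ('n \<Rightarrow> 'k) \<Rightarrow> 'm \<times> 'n \<Rightarrow> 'e \<times> 'k" where
  "prod_lift A A' u w q =
    inv (\<lambda>x. (mdiff (product_atlas A A') A fst q x, mdiff (product_atlas A A') A' snd q x))
      (u (fst q), w (snd q))"

context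
  fixes A :: "('m::{t2_space,second_countable_topology}, 'e::euclidean_space) atlas"
    and A' :: "('n::{t2_space,second_countable_topology}, 'k::euclidean_space) atlas"
  assumes A: "smooth_atlas A" and A': "smooth_atlas A'"
begin

lemma mdiff_prod_lift:
  "mdiff (product_atlas A A') A fst q (prod_lift A A' u w q) = u (fst q)"
  "mdiff (product_atlas A A') A' snd q (prod_lift A A' u w q) = w (snd q)"
  using surj_f_inv_f[OF bij_is_surj[OF bij_mdiff_prod[OF A A', of q]], of "(u (fst q), w (snd q))"]
  unfolding prod_lift_def by auto

lemma vderiv_prod_chart_lift:
  assumes "c \<in> A" "c' \<in> A'" "q \<in> fst (prod_chart c c')"
  shows "vderiv (product_atlas A A') (snd (prod_chart c c')) q (prod_lift A A' u w q)
    = (vderiv A (snd c) (fst q) (u (fst q)), vderiv A' (snd c') (snd q) (w (snd q)))"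
  by (subst vderiv_prod_chart[OF A A' assms(1,2)])
    (use assms(3) in \<open>auto simp: mdiff_prod_lift\<close>)

lemma smooth_field_prod_lift:
  assumes "open U" "open U'" "smooth_field A U u" "smooth_field A' U' w"
  shows "smooth_field (product_atlas A A') (U \<times> U') (prod_lift A A' u w)"
  unfolding smooth_field_def
proof
  let ?P = "product_atlas A A'"
  note P = smooth_atlas_product[OF A A']
  fix d assume "d \<in> ?P"
  then obtain c c' where d: "d = prod_chart c c'" and c: "c \<in> A" and c': "c' \<in> A'"
    unfolding product_atlas_def by blast
  have o: "open (U \<inter> fst c)" "open (U' \<inter> fst c')" "open (U \<times> U' \<inter> fst d)"
    using assms(1,2) chart_open(1)[OF A c] chart_open(1)[OF A' c']
    by (auto simp: d intro!: open_Int open_Times)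
  have 1: "smooth_fun ?P (U \<times> U' \<inter> fst d) (\<lambda>q. vderiv A (snd c) (fst q) (u (fst q)))"
    by (rule smooth_fun_subset[OF P smooth_fun_compose[OF P A smooth_map_fst[OF A A'] o(1)
            smooth_fieldD[OF A assms(3) c]]]) (auto simp: d)
  have 2: "smooth_fun ?P (U \<times> U' \<inter> fst d) (\<lambda>q. vderiv A' (snd c') (snd q) (w (snd q)))"
    by (rule smooth_fun_subset[OF P smooth_fun_compose[OF P A' smooth_map_snd[OF A A'] o(2)
            smooth_fieldD[OF A' assms(4) c']]]) (auto simp: d)
  show "smooth_fun ?P (U \<times> U' \<inter> fst d) (\<lambda>q. vderiv ?P (snd d) q (prod_lift A A' u w q))"
    by (rule smooth_fun_cong[OF P o(3) _ smooth_fun_Pair[OF P o(3) 1 2]])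
      (simp only: d vderiv_prod_chart_lift[OF c c'] Int_iff)
qed

text \<open>In a product chart the components of either lift depend on one factor only, while the
  other lift projects to zero on that factor. Hence both derivatives in the bracket vanish.\<close>

lemma lie_bracket_prod_lift:
  assumes "open U" "open U'" "smooth_field A U u" "smooth_field A' U' w" "p \<in> U \<times> U'"
  shows "lie_bracket (product_atlas A A') (prod_lift A A' u (\<lambda>_. 0)) (prod_lift A A' (\<lambda>_. 0) w) p = 0"
proof -
  let ?P = "product_atlas A A'"
  note P = smooth_atlas_product[OF A A']
  obtain c c' where d: "chart_at ?P p = prod_chart c c'" and c: "c \<in> A" and c': "c' \<in> A'"
    using chart_at(1)[OF P, of p] unfolding product_atlas_def by blast
  let ?d = "prod_chart c c'"
  have pd: "p \<in> fst ?d" using chart_at(2)[OF P, of p] d by simp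
  let ?E = "prod_lift A A' u (\<lambda>_. 0)" and ?T = "prod_lift A A' (\<lambda>_. 0) w"
  let ?V = "U \<times> U' \<inter> fst ?d"
  have oV: "open ?V" and pV: "p \<in> ?V"
    using assms(1,2,5) chart_open(1)[OF A c] chart_open(1)[OF A' c'] pd
    by (auto intro!: open_Int open_Times)
  let ?u = "\<lambda>x. vderiv A (snd c) x (u x)" and ?w = "\<lambda>y. vderiv A' (snd c') y (w y)"
  have du: "mfd_differentiable A ?u (fst p)"
    by (rule smooth_fun_mfd_differentiable[OF A smooth_fieldD[OF A assms(3) c]]) (use pV in auto)
  have dw: "mfd_differentiable A' ?w (snd p)"
    by (rule smooth_fun_mfd_differentiable[OF A' smooth_fieldD[OF A' assms(4) c']]) (use pV in auto)
  note cu = vderiv_compose[OF P A smooth_map_fst[OF A A'] du]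
    and cw = vderiv_compose[OF P A' smooth_map_snd[OF A A'] dw]
  note pu = vderiv_Pair[OF cu(1) vderiv_const(1)[OF P, of 0]]
    and pw = vderiv_Pair[OF vderiv_const(1)[OF P, of 0] cw(1)]
  have "vderiv ?P (\<lambda>q. vderiv ?P (snd ?d) q (?T q)) p = vderiv ?P (\<lambda>q. (0, ?w (snd q))) p"
    by (rule vderiv_cong(2)[OF P oV pV _ pw(1), symmetric])
      (simp only: vderiv_prod_chart_lift[OF c c'] Int_iff, auto simp: vderiv_chart_linear(3)[OF A c])
  then have "vderiv ?P (\<lambda>q. vderiv ?P (snd ?d) q (?T q)) p (?E p)
      = (vderiv ?P (\<lambda>q. 0) p (?E p), vderiv A' ?w (snd p) 0)"
    unfolding pw(2) cw(2) by (simp add: mdiff_prod_lift)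
  then have 1: "vderiv ?P (\<lambda>q. vderiv ?P (snd ?d) q (?T q)) p (?E p) = 0"
    using linear_0[OF linear_vderiv[OF dw]] by (simp add: vderiv_const(2)[OF P] zero_prod_def)
  have "vderiv ?P (\<lambda>q. vderiv ?P (snd ?d) q (?E q)) p = vderiv ?P (\<lambda>q. (?u (fst q), 0)) p"
    by (rule vderiv_cong(2)[OF P oV pV _ pu(1), symmetric])
      (simp only: vderiv_prod_chart_lift[OF c c'] Int_iff, auto simp: vderiv_chart_linear(3)[OF A' c'])
  then have "vderiv ?P (\<lambda>q. vderiv ?P (snd ?d) q (?E q)) p (?T p)
      = (vderiv A ?u (fst p) 0, vderiv ?P (\<lambda>q. 0) p (?T p))"
    unfolding pu(2) cu(2) by (simp add: mdiff_prod_lift)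
  then have 2: "vderiv ?P (\<lambda>q. vderiv ?P (snd ?d) q (?E q)) p (?T p) = 0"
    using linear_0[OF linear_vderiv[OF du]] by (simp add: vderiv_const(2)[OF P] zero_prod_def)
  show ?thesis
    unfolding lie_bracket_def Let_def d 1 2 by simp
qed

text \<open>For definiteness: a vector of length zero has both projections zero since
  \<open>f > 0\<close>, and the projections together are injective.\<close>

lemma warped_metric_inner_form:
  assumes "inner_form (gB (fst q))" "inner_form (gF (snd q))" "f (fst q) > 0"
  shows "inner_form (warped_metric A gB A' gF f q)"
proof -
  let ?P = "product_atlas A A'"
  note P = smooth_atlas_product[OF A A']
  note l = linear_mdiff[OF P A smooth_map_fst[OF A A'], of q]
    linear_mdiff[OF P A' smooth_map_snd[OF A A'], of q]
  let ?m = "mdiff ?P A fst q" and ?n = "mdiff ?P A' snd q"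
  have pos: "G v v \<ge> 0" if "inner_form G" for G :: "'a::euclidean_space \<Rightarrow> 'a \<Rightarrow> real" and v
    using that inner_form_simps(6)[OF that, of v] unfolding inner_form_def
    by (metis inner_form_simps(6) less_eq_real_def that)
  have "bilinear (warped_metric A gB A' gF f q)"
    unfolding bilinear_def warped_metric_def
    by (intro conjI allI linearI)
      (simp_all add: linear_add[OF l(1)] linear_add[OF l(2)] linear_scale[OF l(1)] linear_scale[OF l(2)]
        inner_form_simps(1-4)[OF assms(1)] inner_form_simps(1-4)[OF assms(2)] algebra_simps)
  moreover have "warped_metric A gB A' gF f q u v = warped_metric A gB A' gF f q v u" for u v
    unfolding warped_metric_def
    by (metis inner_form_sym[OF assms(1)] inner_form_sym[OF assms(2)])
  moreover have "warped_metric A gB A' gF f q v v > 0" if "v \<noteq> 0" for v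
  proof (rule ccontr)
    assume "\<not> ?thesis"
    then have le: "gB (fst q) (?m v) (?m v) + (f (fst q))\<^sup>2 * gF (snd q) (?n v) (?n v) \<le> 0"
      unfolding warped_metric_def by simp
    have "gB (fst q) (?m v) (?m v) \<ge> 0" "(f (fst q))\<^sup>2 * gF (snd q) (?n v) (?n v) \<ge> 0"
      using pos[OF assms(1)] pos[OF assms(2)] by simp_all
    with le have "gB (fst q) (?m v) (?m v) = 0" "(f (fst q))\<^sup>2 * gF (snd q) (?n v) (?n v) = 0"
      by linarith+
    then have "?m v = 0" "?n v = 0"
      using inner_form_zero[OF assms(1)] inner_form_zero[OF assms(2)] assms(3) by auto
    then have "(\<lambda>u. (?m u, ?n u)) v = (\<lambda>u. (?m u, ?n u)) 0"
      using linear_0[OF l(1)] linear_0[OF l(2)] by simp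
    then have "v = 0" using bij_is_inj[OF bij_mdiff_prod[OF A A', of q]] by (rule injD[rotated])
    with that show False by simp
  qed
  ultimately show ?thesis unfolding inner_form_def by blast
qed

end

section \<open>Curves and complex surfaces\<close>

text \<open>Normalise a coordinate field by its length. This supplies the unit field on the fibre
  and also shows that the choice in \<open>laplacian\<close> is made from a nonempty set.\<close>

lemma ex_local_orthonormal_frame_dim1:
  fixes A :: "('m::{t2_space,second_countable_topology}, 'e::euclidean_space) atlas"
  assumes A: "smooth_atlas A" and g: "riemannian_metric A g" and dim: "DIM('e) = 1"
  shows "\<exists>U v. local_orthonormal_frame A g U v \<and> p \<in> U"
proof -
  define c where "c = chart_at A p"
  have c: "c \<in> A" "p \<in> fst c" unfolding c_def by (rule chart_at[OF A])+
  obtain b :: 'e where b: "b \<in> Basis" using nonempty_Basis by blast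
  let ?X = "coord_field A c b" and ?U = "fst c"
  note o = chart_open(1)[OF A c(1)]
  note X = smooth_field_coord[OF A c(1), of b]
  define n where "n q = g q (?X q) (?X q)" for q
  have n: "smooth_fun A ?U n"
    using g X o unfolding riemannian_metric_def n_def by blast
  have npos: "n q > 0" if q: "q \<in> ?U" for q
  proof -
    have "?X q \<noteq> 0"
      using coord_field(1)[OF A c(1) q, of b] vderiv_chart_linear(3)[OF A c(1) q] b
      by (metis nonzero_Basis)
    then show ?thesis
      using riemannian_metric_inner_form[OF g] unfolding inner_form_def n_def by blast
  qed
  let ?v = "\<lambda>q. (n q powr (-1/2)) *\<^sub>R ?X q"
  have v: "smooth_field A ?U ?v"
    by (rule smooth_field_scaleR[OF A o smooth_fun_powr[OF A o n npos] X])
  have "g q (?v q) (?v q) = 1" if q: "q \<in> ?U" for q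
  proof -
    have "g q (?v q) (?v q) = n q powr (-1/2) * n q powr (-1/2) * n q"
      unfolding n_def by (simp add: inner_form_simps(3,4)[OF riemannian_metric_inner_form[OF g]])
    also have "n q powr (-1/2) * n q powr (-1/2) = n q powr (-1)"
      by (simp flip: powr_add)
    finally show ?thesis using npos[OF q] by (simp add: powr_minus)
  qed
  then have "local_orthonormal_frame A g ?U (\<lambda>i. ?v)"
    using o v dim unfolding local_orthonormal_frame_def by simp
  then show ?thesis using c(2) by blast
qed

text \<open>The frame obtained here is one that realises the value chosen in
  \<open>laplacian\<close>, so no comparison between frames is made. Its unit field satisfies
  \<open>nabla e e = 0\<close>: this vector is orthogonal to \<open>e\<close>, which spans the
  line.\<close>

lemma laplacian_dim1:
  fixes A :: "('m::{t2_space,second_countable_topology}, 'e::euclidean_space) atlas"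
  assumes A: "smooth_atlas A" and g: "riemannian_metric A g" and lc: "levi_civita A g nabla"
    and dim: "DIM('e) = 1" and f: "smooth_fun A UNIV f"
  obtains U e where "open U" "p \<in> U" "smooth_field A U e" "\<And>q. q \<in> U \<Longrightarrow> g q (e q) (e q) = 1"
    "laplacian A g nabla f p = - vderiv A (\<lambda>q. vderiv A f q (e q)) p (e p)"
proof -
  let ?R = "\<lambda>r. \<exists>U v. local_orthonormal_frame A g U v \<and> p \<in> U \<and>
        r = (\<Sum>i<DIM('e). vderiv A f p (nabla (v i) (v i) p)
                           - vderiv A (\<lambda>q. vderiv A f q (v i q)) p (v i p))"
  have "\<exists>r. ?R r" using ex_local_orthonormal_frame_dim1[OF A g dim, of p] by blast
  then have "?R (laplacian A g nabla f p)"
    unfolding laplacian_def by (rule someI_ex)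
  then obtain U v where fr: "local_orthonormal_frame A g U v" "p \<in> U"
    and lap: "laplacian A g nabla f p = vderiv A f p (nabla (v 0) (v 0) p)
      - vderiv A (\<lambda>q. vderiv A f q (v 0 q)) p (v 0 p)"
    unfolding dim by (auto simp: lessThan_Suc)
  have U: "open U" and e: "smooth_field A U (v 0)" and ee: "\<And>q. q \<in> U \<Longrightarrow> g q (v 0 q) (v 0 q) = 1"
    using fr(1) dim unfolding local_orthonormal_frame_def by auto
  note G = riemannian_metric_inner_form[OF g, of p]
  have "vderiv A (\<lambda>q. g q (v 0 q) (v 0 q)) p = vderiv A (\<lambda>q. 1) p"
    by (rule vderiv_cong(2)[OF A U fr(2) _ vderiv_const(1)[OF A, of 1], symmetric]) (simp add: ee)
  then have "2 * g p (nabla (v 0) (v 0) p) (v 0 p) = 0"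
    using levi_civita_metric[OF lc U e e e fr(2)] inner_form_sym[OF G, of "v 0 p"]
      vderiv_const(2)[OF A, of "1::real" p "v 0 p"] by simp
  moreover have "v 0 p \<noteq> 0" using ee[OF fr(2)] inner_form_simps(6)[OF G] by force
  ultimately have "nabla (v 0) (v 0) p = 0"
    using inner_form_zero_dim1[OF G dim] by simp
  then have "laplacian A g nabla f p = - vderiv A (\<lambda>q. vderiv A f q (v 0 q)) p (v 0 p)"
    using lap linear_0[OF linear_vderiv[OF smooth_fun_mfd_differentiable[OF A f, of p]]] by simp
  then show ?thesis using that U fr(2) e ee by blast
qed

text \<open>The warped product enters only through a commuting orthogonal frame with lengths 1 and
  \<open>r\<close> and \<open>T r = 0\<close>. The two evaluations of the curvature in the plane of
  \<open>E\<close> and its rotation by \<open>J\<close> are compared here.\<close>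

lemma complex_surface_sectional_curvature:
  fixes A :: "('m::{t2_space,second_countable_topology}, 'e::euclidean_space) atlas"
    and A' :: "('n::{t2_space,second_countable_topology}, 'k::euclidean_space) atlas"
  assumes A: "smooth_atlas A" and lc: "levi_civita A g nabla" and g: "\<And>q. inner_form (g q)"
    and dim: "DIM('e) = 2" and N: "open N" "p \<in> N"
    and E: "smooth_field A N E" and T: "smooth_field A N T" and r: "smooth_fun A N r"
    and rpos: "\<And>q. q \<in> N \<Longrightarrow> r q > 0"
    and EE: "\<And>q. q \<in> N \<Longrightarrow> g q (E q) (E q) = 1" and ET: "\<And>q. q \<in> N \<Longrightarrow> g q (E q) (T q) = 0"
    and TT: "\<And>q. q \<in> N \<Longrightarrow> g q (T q) (T q) = (r q)\<^sup>2"
    and rT: "\<And>q. q \<in> N \<Longrightarrow> vderiv A r q (T q) = 0"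
    and br: "\<And>q. q \<in> N \<Longrightarrow> lie_bracket A E T q = 0"
    and sf: "complex_space_form A' g' nabla' J c" and psi: "isometric_immersion A g A' g' psi"
    and tg: "totally_geodesic A nabla A' nabla' psi" and cs: "complex_submanifold A A' J psi"
  shows "- vderiv A (\<lambda>q. vderiv A r q (E q)) p (E p) / r p = c"
proof -
  have K: "kaehler A' g' nabla' J"
    using sf unfolding complex_space_form_def by (rule conjunct1)
  have sect: "\<And>U X p. open U \<Longrightarrow> smooth_field A' U X \<Longrightarrow> p \<in> U \<Longrightarrow> X p \<noteq> 0 \<Longrightarrow>
      sectional_curvature A' g' nabla' X (\<lambda>q. J q (X q)) p = c"
    using sf[unfolded complex_space_form_def, THEN conjunct2] by simp
  have A': "smooth_atlas A'" and g': "riemannian_metric A' g'" and lc': "levi_civita A' g' nabla'"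
    and JJ: "\<And>y v. J y (J y v) = - v" and gJ: "\<And>y u v. g' y (J y u) (J y v) = g' y u v"
    and Jsm: "\<And>U X. open U \<Longrightarrow> smooth_field A' U X \<Longrightarrow> smooth_field A' U (\<lambda>q. J q (X q))"
    using K unfolding kaehler_def by simp_all
  have sm: "smooth_map A A' psi" and inj: "inj (mdiff A A' psi p)"
    and iso: "\<And>q u v. g' (psi q) (mdiff A A' psi q u) (mdiff A A' psi q v) = g q u v"
    using psi unfolding isometric_immersion_def by blast+
  note G' = riemannian_metric_inner_form[OF g']
  obtain U W where U: "open U" "p \<in> U" "U \<subseteq> N" and W: "open W" "psi ` U \<subseteq> W"
    and ext: "\<And>X. smooth_field A U X \<Longrightarrow>
      \<exists>X'. smooth_field A' W X' \<and> (\<forall>q\<in>U. X' (psi q) = mdiff A A' psi q (X q))"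
    using immersion_extend_fields[OF A A' sm inj dim N] by blast
  have EU: "smooth_field A U E" and TU: "smooth_field A U T" and rU: "smooth_fun A U r"
    using smooth_field_subset[OF A E U(3)] smooth_field_subset[OF A T U(3)]
      smooth_fun_subset[OF A r U(3)] by blast+
  obtain X' where X': "smooth_field A' W X'" and X'rel: "\<And>q. q \<in> U \<Longrightarrow> X' (psi q) = mdiff A A' psi q (E q)"
    using ext[OF EU] by blast
  obtain T' where T': "smooth_field A' W T'" and T'rel: "\<And>q. q \<in> U \<Longrightarrow> T' (psi q) = mdiff A A' psi q (T q)"
    using ext[OF TU] by blast
  \<comment> \<open>The space form condition needs \<open>J X'\<close> as a field on an open set of
    the ambient manifold, so \<open>J\<close> is applied after the extension and not before.\<close>
  define JX where "JX = (\<lambda>y. J y (X' y))"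
  have JX: "smooth_field A' W JX" unfolding JX_def by (rule Jsm[OF W(1) X'])
  \<comment> \<open>The coefficient of \<open>J E\<close> along \<open>T\<close>, as
    \<open>r powr (-2)\<close> is the inverse of the squared length of \<open>T\<close>. Using the
    extension \<open>T'\<close> makes the numerator the composition of a smooth ambient function
    with \<open>psi\<close>.\<close>
  define h where "h q = g' (psi q) (JX (psi q)) (T' (psi q)) * r q powr (-2)" for q
  have "smooth_fun A' W (\<lambda>y. g' y (JX y) (T' y))"
    using g' W(1) JX T' unfolding riemannian_metric_def by blast
  then have 1: "smooth_fun A U (\<lambda>q. g' (psi q) (JX (psi q)) (T' (psi q)))"
    by (rule smooth_fun_subset[OF A smooth_fun_compose[OF A A' sm W(1)]]) (use W(2) in blast)
  have 2: "smooth_fun A U (\<lambda>q. r q powr (-2))"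
    by (rule smooth_fun_powr[OF A U(1) rU]) (use rpos U(3) in blast)
  have h: "smooth_fun A U h"
    unfolding h_def using smooth_fun_scaleR[OF A U(1) 1 2] by simp
  define Z where "Z = (\<lambda>q. h q *\<^sub>R T q)"
  have Z: "smooth_field A U Z" unfolding Z_def by (rule smooth_field_scaleR[OF A U(1) h TU])
  have JXrel: "JX (psi q) = mdiff A A' psi q (Z q)" and hr: "(h q)\<^sup>2 * (r q)\<^sup>2 = 1" if q: "q \<in> U" for q
  proof -
    have qN: "q \<in> N" using q U(3) by blast
    let ?d = "mdiff A A' psi q"
    have "J (psi q) (?d (E q)) \<in> range ?d"
      using cs unfolding complex_submanifold_def by blast
    then obtain w where w: "J (psi q) (?d (E q)) = ?d w" by blast
    then have JXw: "JX (psi q) = ?d w" using X'rel[OF q] by (simp add: JX_def)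
    \<comment> \<open>\<open>w\<close> represents \<open>J E\<close> on the surface. Since
      \<open>J\<close> preserves \<open>g'\<close> and \<open>J J = -1\<close>, the inner product of
      \<open>J E\<close> with \<open>E\<close> equals its own negative.\<close>
    have "g' (psi q) (?d w) (?d (E q)) = g' (psi q) (J (psi q) (?d w)) (J (psi q) (?d (E q)))"
      by (simp add: gJ)
    also have "\<dots> = - g' (psi q) (?d (E q)) (?d w)"
      using inner_form_simps(3)[OF G', of "psi q" "-1" "?d (E q)" "?d w"] JJ
      by (simp add: w flip: w)
    finally have wE: "g q w (E q) = 0"
      using inner_form_sym[OF G', of "psi q" "?d w"] by (simp add: iso inner_form_sym[OF g, of q w])
    have "g' (psi q) (JX (psi q)) (T' (psi q)) = g q w (T q)"
      unfolding JXw T'rel[OF q] iso ..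
    then have wT: "g q w (T q) = h q * (r q)\<^sup>2"
      using rpos[OF qN] by (simp add: h_def powr_minus powr_numeral)
    have "w = 0 *\<^sub>R E q + h q *\<^sub>R T q"
      by (rule inner_form_expand_dim2[OF g dim, of q])
        (use EE[OF qN] ET[OF qN] TT[OF qN] rpos[OF qN] wE wT in simp_all)
    then have wZ: "w = Z q" by (simp add: Z_def)
    show "JX (psi q) = ?d (Z q)" using JXw wZ by simp
    \<comment> \<open>\<open>J\<close> preserves length, so \<open>w = h T\<close> is a unit vector;
      this is where the sign of \<open>h\<close> stays open.\<close>
    have "g q w w = g' (psi q) (J (psi q) (?d (E q))) (J (psi q) (?d (E q)))"
      unfolding w iso ..
    also have "\<dots> = 1" unfolding gJ iso by (rule EE[OF qN])
    finally show "(h q)\<^sup>2 * (r q)\<^sup>2 = 1"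
      unfolding wZ Z_def by (simp add: inner_form_simps(3,4)[OF g] TT[OF qN] power2_eq_square)
  qed
  let ?k = "- vderiv A (\<lambda>q. vderiv A r q (E q)) p (E p) / r p"
  have pN: "p \<in> N" by (rule N(2))
  have pW: "psi p \<in> W" using U(2) W(2) by blast
  have cM: "curvature A nabla E Z Z p = ?k *\<^sub>R E p"
    unfolding Z_def
    by (rule warped_frame_curvature[OF A lc g dim U(1) EU TU rU h])
      (use U(2,3) rpos EE ET TT rT br hr in blast)+
  have cN: "curvature A' nabla' X' JX JX (psi p) = mdiff A A' psi p (?k *\<^sub>R E p)"
    using curvature_related[OF A A' sm lc lc' tg U(1,2) W EU Z Z X' JX JX X'rel JXrel JXrel] cM by simp
  have num: "g' (psi p) (curvature A' nabla' X' JX JX (psi p)) (X' (psi p)) = ?k"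
    unfolding cN X'rel[OF U(2)] iso inner_form_simps(3)[OF g] EE[OF pN] by simp
  \<comment> \<open>\<open>X'\<close> and \<open>J X'\<close> are orthonormal at
    \<open>psi p\<close>, so the denominator of the sectional curvature is 1 and its numerator is
    the coefficient of \<open>E\<close>.\<close>
  have den: "g' (psi p) (X' (psi p)) (X' (psi p)) = 1" "g' (psi p) (JX (psi p)) (JX (psi p)) = 1"
    using EE[OF pN] by (simp_all add: JX_def gJ X'rel[OF U(2)] iso)
  have ort: "g' (psi p) (X' (psi p)) (JX (psi p)) = 0"
    unfolding X'rel[OF U(2)] JXrel[OF U(2)] iso Z_def
    by (simp add: inner_form_simps(4)[OF g] ET[OF pN])
  have "X' (psi p) \<noteq> 0" using den(1) inner_form_simps(6)[OF G'] by force
  then have "sectional_curvature A' g' nabla' X' JX (psi p) = c"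
    unfolding JX_def by (rule sect[OF W(1) X' pW])
  then show ?thesis
    unfolding sectional_curvature_def num den ort by simp
qed

section \<open>The warped product of two curves\<close>

theorem corollary3p9:
  fixes AB :: "('b::{t2_space,second_countable_topology}, 'd::euclidean_space) atlas"
    and gB :: "'b \<Rightarrow> 'd \<Rightarrow> 'd \<Rightarrow> real"
    and nablaB :: "('b \<Rightarrow> 'd) \<Rightarrow> ('b \<Rightarrow> 'd) \<Rightarrow> 'b \<Rightarrow> 'd"
    and AF :: "('f::{t2_space,second_countable_topology}, 'e::euclidean_space) atlas"
    and gF :: "'f \<Rightarrow> 'e \<Rightarrow> 'e \<Rightarrow> real"
    and f :: "'b \<Rightarrow> real"
    and AM :: "('b \<times> 'f, 'd \<times> 'e) atlas"
    and g :: "'b \<times> 'f \<Rightarrow> 'd \<times> 'e \<Rightarrow> 'd \<times> 'e \<Rightarrow> real"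
    and nabla :: "('b \<times> 'f \<Rightarrow> 'd \<times> 'e) \<Rightarrow> ('b \<times> 'f \<Rightarrow> 'd \<times> 'e) \<Rightarrow> 'b \<times> 'f \<Rightarrow> 'd \<times> 'e"
    and A' :: "('n::{t2_space,second_countable_topology}, 'k::euclidean_space) atlas"
    and g' :: "'n \<Rightarrow> 'k \<Rightarrow> 'k \<Rightarrow> real"
    and nabla' :: "('n \<Rightarrow> 'k) \<Rightarrow> ('n \<Rightarrow> 'k) \<Rightarrow> 'n \<Rightarrow> 'k"
    and J :: "'n \<Rightarrow> 'k \<Rightarrow> 'k"
    and c :: real
    and psi :: "'b \<times> 'f \<Rightarrow> 'n"
    and p :: "'b \<times> 'f"
  assumes B: "smooth_atlas AB" "riemannian_metric AB gB" "levi_civita AB gB nablaB"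
    and F: "smooth_atlas AF" "riemannian_metric AF gF"
    and f: "smooth_fun AB UNIV f" "\<And>x. f x > 0"
    and M: "AM = product_atlas AB AF" "g = warped_metric AB gB AF gF f" "levi_civita AM g nabla"
    and N: "complex_space_form A' g' nabla' J c"
    and psi: "isometric_immersion AM g A' g' psi"
    and dim: "DIM('d \<times> 'e) = 2"
    and tot_geo: "totally_geodesic AM nabla A' nabla' psi"
    and complex: "complex_submanifold AM A' J psi"
  shows "real DIM('d) * c \<le> laplacian AB gB nablaB f (fst p) / f (fst p) \<and>
         laplacian AB gB nablaB f (fst p) / f (fst p) \<le> real DIM('d) * c"
proof -
  \<comment> \<open>Euclidean spaces have positive dimension, so a sum of 2 leaves only 1 and 1;
    this also turns the factor \<open>DIM('d)\<close> of the claim into 1.\<close>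
  have d1: "DIM('d) = 1" "DIM('e) = 1"
    using dim DIM_positive[where 'a='d] DIM_positive[where 'a='e] unfolding DIM_prod by arith+
  note AM = smooth_atlas_product[OF B(1) F(1)]
  obtain U1 e where U1: "open U1" "fst p \<in> U1" and e: "smooth_field AB U1 e"
    and ee: "\<And>x. x \<in> U1 \<Longrightarrow> gB x (e x) (e x) = 1"
    and lap: "laplacian AB gB nablaB f (fst p) = - vderiv AB (\<lambda>x. vderiv AB f x (e x)) (fst p) (e (fst p))"
    using laplacian_dim1[OF B d1(1) f(1)] by blast
  obtain U2 v where "local_orthonormal_frame AF gF U2 v" and pU2: "snd p \<in> U2"
    using ex_local_orthonormal_frame_dim1[OF F d1(2)] by blast
  then have U2: "open U2" and t: "smooth_field AF U2 (v 0)" and tt: "\<And>y. y \<in> U2 \<Longrightarrow> gF y (v 0 y) (v 0 y) = 1"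
    using d1(2) unfolding local_orthonormal_frame_def by auto
  \<comment> \<open>The fibre field is lifted without rescaling, so that the lifts commute; the
    price is that \<open>T\<close> has length \<open>f\<close>.\<close>
  define E where "E = prod_lift AB AF e (\<lambda>_. 0)"
  define T where "T = prod_lift AB AF (\<lambda>_. 0) (v 0)"
  have dE: "mdiff AM AB fst q (E q) = e (fst q)" "mdiff AM AF snd q (E q) = 0"
    and dT: "mdiff AM AB fst q (T q) = 0" "mdiff AM AF snd q (T q) = v 0 (snd q)" for q
    unfolding E_def T_def M(1) by (simp_all add: mdiff_prod_lift[OF B(1) F(1)])
  note gBi = riemannian_metric_inner_form[OF B(2)] and gFi = riemannian_metric_inner_form[OF F(2)]
  have gi: "inner_form (g q)" for q
    unfolding M(2) by (rule warped_metric_inner_form[OF B(1) F(1) gBi gFi f(2)])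
  have gval: "g q u w = gB (fst q) (mdiff AM AB fst q u) (mdiff AM AB fst q w)
      + (f (fst q))\<^sup>2 * gF (snd q) (mdiff AM AF snd q u) (mdiff AM AF snd q w)" for q u w
    unfolding M(1,2) warped_metric_def ..
  have smE: "smooth_field AM (U1 \<times> U2) E" and smT: "smooth_field AM (U1 \<times> U2) T"
    unfolding E_def T_def M(1)
    by (intro smooth_field_prod_lift[OF B(1) F(1) U1(1) U2] e t
        smooth_field_zero[OF B(1)] smooth_field_zero[OF F(1)])+
  have o: "open (U1 \<times> U2)" "p \<in> U1 \<times> U2"
    using U1 U2 pU2 by (auto intro: open_Times simp: mem_Times_iff)
  define r where "r q = f (fst q)" for q :: "'b \<times> 'f"
  note fstm = smooth_map_fst[OF B(1) F(1), folded M(1)]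
  have AM': "smooth_atlas AM" unfolding M(1) by (rule AM)
  have r: "smooth_fun AM (U1 \<times> U2) r"
    using smooth_fun_subset[OF AM' smooth_fun_compose[OF AM' B(1) fstm open_UNIV f(1)]]
    unfolding r_def by auto
  \<comment> \<open>The derivative of \<open>r\<close> is the derivative of \<open>f\<close> along
    the projected vector: it is \<open>e f\<close> along \<open>E\<close> and vanishes along
    \<open>T\<close>, whose projection is zero.\<close>
  note rd = vderiv_compose(2)[OF AM' B(1) fstm smooth_fun_mfd_differentiable[OF B(1) f(1) UNIV_I], folded r_def]
  define f1 where "f1 x = vderiv AB f x (e x)" for x
  have rE: "vderiv AM r q (E q) = f1 (fst q)" for q
    unfolding rd dE f1_def ..
  have f1: "smooth_fun AB U1 f1"
    unfolding f1_def by (rule smooth_fun_vderiv[OF B(1) U1(1) smooth_fun_subset[OF B(1) f(1)] e]) simp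
  have "- vderiv AM (\<lambda>q. vderiv AM r q (E q)) p (E p) / r p = c"
  proof (rule complex_surface_sectional_curvature[OF AM' M(3) gi dim o smE smT r _ _ _ _ _ _ N psi tot_geo complex])
    fix q assume q: "q \<in> U1 \<times> U2"
    show "r q > 0" by (simp add: r_def f(2))
    show "g q (E q) (E q) = 1"
      using q by (auto simp: gval dE ee inner_form_simps(6)[OF gFi])
    show "g q (E q) (T q) = 0"
      by (simp add: gval dE dT inner_form_simps(6)[OF gFi] inner_form_simps(7)[OF gBi])
    show "g q (T q) (T q) = (r q)\<^sup>2"
      using q by (auto simp: gval dT tt r_def inner_form_simps(6)[OF gBi])
    show "vderiv AM r q (T q) = 0"
      unfolding rd dT
      by (rule linear_0[OF linear_vderiv[OF smooth_fun_mfd_differentiable[OF B(1) f(1) UNIV_I]]])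
    show "lie_bracket AM E T q = 0"
      unfolding E_def T_def M(1) by (rule lie_bracket_prod_lift[OF B(1) F(1) U1(1) U2 e t q])
  qed
  \<comment> \<open>The first derivative of \<open>r\<close> along \<open>E\<close> is again a
    function pulled back from the base, so the same rule applies once more and gives the second
    derivative occurring in the Laplacian.\<close>
  moreover have "vderiv AM (\<lambda>q. vderiv AM r q (E q)) p (E p) = vderiv AB f1 (fst p) (e (fst p))"
    unfolding rE
    using vderiv_compose(2)[OF AM' B(1) fstm smooth_fun_mfd_differentiable[OF B(1) f1 U1(2)], of "E p"]
    by (simp add: dE)
  ultimately have "laplacian AB gB nablaB f (fst p) / f (fst p) = c"
    unfolding lap f1_def r_def by simp
  then show ?thesis using d1(1) by simp
qed

end
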